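(* Consider the one-dimensional case $d=1$, with the random coefficient $A_\eta$, the apparent homogenized coefficient $A^\star_{\eta,N}$ and the second-order controlled variable $D^{3,\eta}_{\rho_1,\rho_2,\rho_3}$ as defined in the context, where $\eta\in(0,1)$ is fixed. For the optimal value of the deterministic parameters $\rho_1,\rho_2,\rho_3\in\mathbb{R}$ (which may depend on $N$ and $\eta$), one has, as $N\to\infty$, $$\min_{\rho_1,\rho_2,\rho_3\in\mathbb{R}}\mathrm{Var}\big(D^{3,\eta}_{\rho_1,\rho_2,\rho_3}\big)=O\!\left(\frac1{N^3}\right).$$
   Context: Let $d=1$, $Q=(0,1)$, and for an integer $N\ge 2$ let $Q_N=(0,N)$ and $\mathcal{I}_N=\{k\in\mathbb{Z}:\ k+Q\subset Q_N\}=\{0,\dots,N-1\}$. Let $A_{\rm per},C_{\rm per}:\mathbb{R}\to\mathbb{R}$ be measurable, $\mathbb{Z}$-periodic, bounded, and bounded from below by a positive constant. Let $\eta\in(0,1)$ and let $(B^\eta_k)_{k\in\mathbb{Z}}$ be i.i.d. Bernoulli random variables on a probability space $(\Omega,\mathcal F,\mathbb P)$: $\mathbb{P}(B^\eta_k=1)=\eta$, $\mathbb{P}(B^\eta_k=0)=1-\eta$. Set $$A_\eta(x,\omega)=A_{\rm per}(x)+\Big(\sum_{k\in\mathbb{Z}}\mathbf 1_{Q+k}(x)B^\eta_k(\omega)\Big)\big(C_{\rm per}(x)-A_{\rm per}(x)\big).$$ Apparent homogenized coefficient on $Q_N$: for a bounded measurable coefficient $A$ on $Q_N$ bounded from below by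 a positive constant (extended $Q_N$-periodically), and $p\in\mathbb{R}$, let $w_p^N$ be the $Q_N$-periodic weak solution (unique up to an additive constant) of $-\big(A(p+(w_p^N)')\big)'=0$, and define the number $\mathrm{Hom}_N(A)$ by $\mathrm{Hom}_N(A)\,p=\frac1{|Q_N|}\int_{Q_N}A\,(p+(w_p^N)')\,dx$ for all $p\in\mathbb{R}$. Then define, for $k,l\in\mathcal I_N$ with $k\ne l$: - $A^\star_{\eta,N}(\omega)=\mathrm{Hom}_N(A_\eta(\cdot,\omega))$; - $A^\star_{\rm per}$ (resp. $C^\star_{\rm per}$): the periodic homogenized coefficient associated with $A_{\rm per}$ (resp. $C_{\rm per}$), i.e. $A^\star_{\rm per}\,p=\int_Q A_{\rm per}(p+(w_p^0)')\,dx$ with $w_p^0$ the $Q$-periodic solution of $-\big(A_{\rm per}(p+(w_p^0)')\big)'=0$, and similarly with $C_{\rm per}$; - $A^\star_{1,k,N}=\mathrm{Hom}_N\big(A_{\rm per}+\mathbf 1_{k+Q}(C_{\rm per}-A_{\rm per})\big)$ and $A^\star_{2,k,l,N}=\mathrm{Hom}_N\big(A_{\rm per}+(\mathbf 1_{k+Q}+\mathbf 1_{l+Q})(C_{\rm per}-A_{\rm per})\big)$; - $C^\star_{1,k,N}=\mathrm{Hom}_N\big(C_{\rm per}-\mathbf 1_{k+Q}(C_{\rm per}-A_{\rm per})\big)$ and $C^\star_{2,k,l,N}=\mathrm{Hom}_N\big(C_{\rm per}-(\mathbf 1_{k+Q}+\mathbf 1_{l+Q})(C_{\rm per}-A_{\rm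 per})\big)$; - $\overline A^{k,N}_{1\,\rm def}=A^\star_{1,k,N}-A^\star_{\rm per}$, $\ \overline A^{k,l,N}_{2\,\rm def}=A^\star_{2,k,l,N}-A^\star_{1,k,N}-A^\star_{1,l,N}+A^\star_{\rm per}$, $\ \overline C^{k,l,N}_{2\,\rm def}=C^\star_{2,k,l,N}-C^\star_{1,k,N}-C^\star_{1,l,N}+C^\star_{\rm per}$; - $A^{\eta,N}_1(\omega)=\sum_{k\in\mathcal I_N}B^\eta_k(\omega)\,\overline A^{k,N}_{1\,\rm def}$, with expectation $\eta\overline A^N_1$ where $\overline A^N_1=\sum_{k\in\mathcal I_N}\overline A^{k,N}_{1\,\rm def}$; - $A^{\eta,N}_2(\omega)=\frac12\sum_{k\in\mathcal I_N}\sum_{l\in\mathcal I_N,\,l\ne k}B^\eta_k(\omega)B^\eta_l(\omega)\,\overline A^{k,l,N}_{2\,\rm def}$, with expectation $\eta^2\overline A^N_2$ where $\overline A^N_2=\frac12\sum_{k\in\mathcal I_N}\sum_{l\in\mathcal I_N,\,l\neq k}\overline A^{k,l,N}_{2\,\rm def}$; - $C^{\eta,N}_2(\omega)=\frac12\sum_{k\in\mathcal I_N}\sum_{l\in\mathcal I_N,\,l\ne k}(1-B^\eta_k(\omega))(1-B^\eta_l(\omega))\,\overline C^{k,l,N}_{2\,\rm def}$, with expectation $\overline C^{\eta,N}_2=\mathbb E[C^{\eta,N}_2]$. The second-order controlled variable is, for deterministic $\rho_1,\rho_2,\rho_3\in\mathbb{R}$, $$D^{3,\eta}_{\rho_1,\rho_2,\rho_3}(\omega)=A^\star_{\eta,N}(\omega)-\rho_1\big(A^{\eta,N}_1(\omega)-\eta\overline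 A^N_1\big)-\rho_2\big(A^{\eta,N}_2(\omega)-\eta^2\overline A^N_2\big)-\rho_3\big(C^{\eta,N}_2(\omega)-\overline C^{\eta,N}_2\big).$$ The constant in the $O(\cdot)$ term is independent of $N$ (it may depend on $\eta$, $A_{\rm per}$, $C_{\rm per}$). The parameter $\eta$ is not assumed to be small. *)

theory Defs
  imports "HOL-Probability.Probability" "HOL-Library.Landau_Symbols"
begin

definition QN :: "nat \<Rightarrow> real set" where
  "QN N = {0<..<real N}"

definition cell :: "int \<Rightarrow> real set" where
  "cell k = {real_of_int k<..<real_of_int k + 1}"

definition cells :: "nat \<Rightarrow> int set" where
  "cells N = {k. cell k \<subseteq> QN N}"

definition L2 :: "nat \<Rightarrow> (real \<Rightarrow> real) \<Rightarrow> bool" where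
  "L2 N f \<longleftrightarrow> f \<in> borel_measurable (lebesgue_on (QN N)) \<and>
     integrable (lebesgue_on (QN N)) (\<lambda>x. (f x)\<^sup>2)"

definition periodic_test :: "nat \<Rightarrow> (real \<Rightarrow> real) \<Rightarrow> bool" where
  "periodic_test N \<phi> \<longleftrightarrow>
     (\<forall>x. \<phi> (x + real N) = \<phi> x) \<and> (\<forall>n x. (deriv ^^ n) \<phi> differentiable (at x))"

text \<open>\<open>H1_per N w g\<close>: \<open>w\<close> belongs to the periodic Sobolev space of \<open>QN N\<close> and \<open>g\<close> represents
  its weak derivative. The test functions are smooth on the torus and need not vanish at the
  endpoints \<open>0\<close> and \<open>N\<close>, so jumps of \<open>w\<close> across the period boundary are excluded.\<close>

definition H1_per :: "nat \<Rightarrow> (real \<Rightarrow> real) \<Rightarrow> (real \<Rightarrow> real) \<Rightarrow> bool" where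
  "H1_per N w g \<longleftrightarrow>
     (\<forall>x. w (x + real N) = w x) \<and> L2 N w \<and> L2 N g \<and>
     (\<forall>\<phi>. periodic_test N \<phi> \<longrightarrow>
        (LINT x|lebesgue_on (QN N). w x * deriv \<phi> x) =
        - (LINT x|lebesgue_on (QN N). g x * \<phi> x))"

text \<open>Weak form of \<open>- (a (p + w'))' = 0\<close>, with \<open>g\<close> standing for \<open>w'\<close>. Only the values of \<open>a\<close>
  on \<open>QN N\<close> enter, so the periodic extension of \<open>a\<close> need not be made explicit.\<close>

definition corrector :: "nat \<Rightarrow> (real \<Rightarrow> real) \<Rightarrow> real \<Rightarrow> (real \<Rightarrow> real) \<Rightarrow> (real \<Rightarrow> real) \<Rightarrow> bool" where
  "corrector N a p w g \<longleftrightarrow> H1_per N w g \<and>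
     (\<forall>v h. H1_per N v h \<longrightarrow> (LINT x|lebesgue_on (QN N). a x * (p + g x) * h x) = 0)"

text \<open>The corrector is unique up to an additive constant, so its weak derivative is unique almost
  everywhere and the number below is well defined for bounded coefficients bounded from below by
  a positive constant.\<close>

definition Hom :: "nat \<Rightarrow> (real \<Rightarrow> real) \<Rightarrow> real" where
  "Hom N a = (THE s. \<forall>p. \<exists>w g. corrector N a p w g \<and>
     s * p = 1 / measure lebesgue (QN N) * (LINT x|lebesgue_on (QN N). a x * (p + g x)))"

definition admissible :: "(real \<Rightarrow> real) \<Rightarrow> bool" where
  "admissible a \<longleftrightarrow> a \<in> borel_measurable lebesgue \<and> (\<forall>x. a (x + 1) = a x) \<and>
     (\<exists>\<alpha>>0. \<exists>\<beta>. \<forall>x. \<alpha> \<le> a x \<and> a x \<le> \<beta>)"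

definition bernoulli_iid :: "'w measure \<Rightarrow> real \<Rightarrow> (int \<Rightarrow> 'w \<Rightarrow> real) \<Rightarrow> bool" where
  "bernoulli_iid M \<eta> B \<longleftrightarrow>
     prob_space.indep_vars M (\<lambda>_. borel) B UNIV \<and>
     (\<forall>k. \<forall>\<omega>\<in>space M. B k \<omega> \<in> {0, 1}) \<and>
     (\<forall>k. measure M {\<omega>\<in>space M. B k \<omega> = 1} = \<eta> \<and>
          measure M {\<omega>\<in>space M. B k \<omega> = 0} = 1 - \<eta>)"

definition A_eta ::
  "(real \<Rightarrow> real) \<Rightarrow> (real \<Rightarrow> real) \<Rightarrow> (int \<Rightarrow> 'w \<Rightarrow> real) \<Rightarrow> 'w \<Rightarrow> real \<Rightarrow> real" where
  "A_eta A C B \<omega> x = A x + (\<Sum>\<^sub>\<infinity>k\<in>UNIV. indicator (cell k) x * B k \<omega>) * (C x - A x)"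

definition A_star ::
  "(real \<Rightarrow> real) \<Rightarrow> (real \<Rightarrow> real) \<Rightarrow> (int \<Rightarrow> 'w \<Rightarrow> real) \<Rightarrow> nat \<Rightarrow> 'w \<Rightarrow> real" where
  "A_star A C B N \<omega> = Hom N (A_eta A C B \<omega>)"

definition per_star :: "(real \<Rightarrow> real) \<Rightarrow> real" where
  "per_star a = Hom 1 a"

context
  fixes A C :: "real \<Rightarrow> real" and N :: nat
begin

definition A1_star :: "int \<Rightarrow> real" where
  "A1_star k = Hom N (\<lambda>x. A x + indicator (cell k) x * (C x - A x))"

definition A2_star :: "int \<Rightarrow> int \<Rightarrow> real" where
  "A2_star k l = Hom N (\<lambda>x. A x + (indicator (cell k) x + indicator (cell l) x) * (C x - A x))"

definition C1_star :: "int \<Rightarrow> real" where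
  "C1_star k = Hom N (\<lambda>x. C x - indicator (cell k) x * (C x - A x))"

definition C2_star :: "int \<Rightarrow> int \<Rightarrow> real" where
  "C2_star k l = Hom N (\<lambda>x. C x - (indicator (cell k) x + indicator (cell l) x) * (C x - A x))"

definition A1_defect :: "int \<Rightarrow> real" where
  "A1_defect k = A1_star k - per_star A"

definition A2_defect :: "int \<Rightarrow> int \<Rightarrow> real" where
  "A2_defect k l = A2_star k l - A1_star k - A1_star l + per_star A"

definition C2_defect :: "int \<Rightarrow> int \<Rightarrow> real" where
  "C2_defect k l = C2_star k l - C1_star k - C1_star l + per_star C"

definition A1_bar :: real where
  "A1_bar = (\<Sum>k\<in>cells N. A1_defect k)"

definition A2_bar :: real where
  "A2_bar = 1 / 2 * (\<Sum>k\<in>cells N. \<Sum>l\<in>cells N - {k}. A2_defect k l)"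

definition A1_eta :: "(int \<Rightarrow> 'w \<Rightarrow> real) \<Rightarrow> 'w \<Rightarrow> real" where
  "A1_eta B \<omega> = (\<Sum>k\<in>cells N. B k \<omega> * A1_defect k)"

definition A2_eta :: "(int \<Rightarrow> 'w \<Rightarrow> real) \<Rightarrow> 'w \<Rightarrow> real" where
  "A2_eta B \<omega> = 1 / 2 * (\<Sum>k\<in>cells N. \<Sum>l\<in>cells N - {k}. B k \<omega> * B l \<omega> * A2_defect k l)"

definition C2_eta :: "(int \<Rightarrow> 'w \<Rightarrow> real) \<Rightarrow> 'w \<Rightarrow> real" where
  "C2_eta B \<omega> =
     1 / 2 * (\<Sum>k\<in>cells N. \<Sum>l\<in>cells N - {k}. (1 - B k \<omega>) * (1 - B l \<omega>) * C2_defect k l)"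

end

definition D3 ::
  "'w measure \<Rightarrow> real \<Rightarrow> (int \<Rightarrow> 'w \<Rightarrow> real) \<Rightarrow> (real \<Rightarrow> real) \<Rightarrow> (real \<Rightarrow> real) \<Rightarrow> nat \<Rightarrow>
    real \<Rightarrow> real \<Rightarrow> real \<Rightarrow> 'w \<Rightarrow> real" where
  "D3 M \<eta> B A C N \<rho>1 \<rho>2 \<rho>3 \<omega> = A_star A C B N \<omega>
     - \<rho>1 * (A1_eta A C N B \<omega> - \<eta> * A1_bar A C N)
     - \<rho>2 * (A2_eta A C N B \<omega> - \<eta>\<^sup>2 * A2_bar A C N)
     - \<rho>3 * (C2_eta A C N B \<omega> - prob_space.expectation M (C2_eta A C N B))"

end

theory Submission
  imports Defs
begin

text \<open>
In dimension one the corrector equation says that the flux \<open>a (p + w')\<close> is constant, so the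
effective coefficient of a cell problem is the harmonic mean of \<open>a\<close> (\<open>Hom_harmonic_mean\<close>). It
therefore sees a random two-phase medium only through the number \<open>S\<close> of cells occupied by \<open>C\<close>:
with \<open>\<alpha>\<close> and \<open>\<gamma>\<close> the averages of \<open>1 / A\<close> and \<open>1 / C\<close> over one period, the apparent
coefficient is \<open>h (S / N)\<close> where \<open>h t = 1 / (\<alpha> + t (\<gamma> - \<alpha>))\<close> (\<open>A_star_eq\<close>).

All one-defect corrections are then equal, and so are all two-defect corrections. Hence the first
control variate is a multiple of \<open>S\<close> and the second a multiple of \<open>S (S - 1)\<close>. If
\<open>\<alpha> \<noteq> \<gamma>\<close>, the two multiples are nonzero, being a first and a second difference of the strictly
monotone and strictly convex function \<open>h\<close>; if \<open>\<alpha> = \<gamma>\<close>, then \<open>h\<close> is constant and there is nothing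
to correct. In both cases the two control variates remove, up to a constant, the second order
Taylor polynomial of \<open>h\<close> at \<open>\<eta>\<close> (\<open>mixed_mean_quadratic_approximation\<close>), and what is left of \<open>h (S / N)\<close> is of
size \<open>\<bar>S / N - \<eta>\<bar> ^ 3\<close>, uniformly in \<open>N\<close>. Its variance is at most a constant times the sixth
moment of \<open>S / N - \<eta>\<close>, which is \<open>O(1 / N ^ 3)\<close> by a Hoeffding bound on the exponential moments
(\<open>bernoulli_even_moment\<close>). These two coefficients, together with \<open>0\<close> for the third control
variate, bound the minimum from above.

That the minimum is attained is a separate matter: the variance is the squared \<open>L\<^sup>2\<close> distance
from the centered apparent coefficient to an element of the span of three centered variables, and
a finite-dimensional subspace contains a closest point (\<open>variance_minimizer\<close>).
\<close>

section \<open>The cell problem in one dimension\<close>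

lemma QN_sets: "QN N \<in> sets lebesgue"
  by (simp add: QN_def)

lemma finite_measure_QN: "finite_measure (lebesgue_on (QN N))"
  by (rule finite_measure_lebesgue_on) (simp add: QN_def bounded_set_imp_lmeasurable)

lemma measure_QN: "measure lebesgue (QN N) = real N"
  by (simp add: QN_def)

lemma measure_lebesgue_on_QN: "measure (lebesgue_on (QN N)) (QN N) = real N"
  by (simp add: measure_restrict_space QN_sets measure_QN)

lemma integrable_bounded_QN:
  fixes f :: "real \<Rightarrow> real"
  assumes "f \<in> borel_measurable (lebesgue_on (QN N))" "\<And>x. x \<in> QN N \<Longrightarrow> \<bar>f x\<bar> \<le> b"
  shows "integrable (lebesgue_on (QN N)) f"
proof -
  interpret finite_measure "lebesgue_on (QN N)" by (rule finite_measure_QN)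
  show ?thesis
    by (rule integrable_const_bound[of _ b]) (use assms in \<open>auto intro!: AE_I2\<close>)
qed

lemma L2_bounded:
  assumes f: "f \<in> borel_measurable (lebesgue_on (QN N))"
    and b: "\<And>x. x \<in> QN N \<Longrightarrow> \<bar>f x\<bar> \<le> b"
  shows "L2 N f"
  unfolding L2_def
proof (intro conjI integrable_bounded_QN[where b = "b\<^sup>2"])
  show "\<bar>(f x)\<^sup>2\<bar> \<le> b\<^sup>2" if "x \<in> QN N" for x
    using b[OF that] abs_le_square_iff[of "f x" b] by simp
qed (use f in auto)

lemma periodic_test_props:
  assumes "periodic_test N \<phi>"
  shows periodic_test_periodic: "\<phi> (x + real N) = \<phi> x"
    and periodic_test_deriv: "(\<phi> has_field_derivative deriv \<phi> x) (at x)"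
    and periodic_test_cont_deriv: "continuous_on UNIV (deriv \<phi>)"
proof -
  have d: "(deriv ^^ n) \<phi> differentiable (at x)" for n x
    using assms by (auto simp: periodic_test_def)
  show "\<phi> (x + real N) = \<phi> x"
    using assms by (auto simp: periodic_test_def)
  show "(\<phi> has_field_derivative deriv \<phi> x) (at x)"
    using d[of 0 x] by (simp add: DERIV_deriv_iff_real_differentiable)
  show "continuous_on UNIV (deriv \<phi>)"
    using d[of 1] by (intro continuous_at_imp_continuous_on ballI)
      (simp add: differentiable_imp_continuous_within)
qed

lemma continuous_QN:
  fixes f :: "real \<Rightarrow> real"
  assumes f: "continuous_on UNIV f"
  shows continuous_measurable_QN: "f \<in> borel_measurable (lebesgue_on (QN N))"
    and continuous_bounded_QN: "\<exists>K\<ge>0. \<forall>x\<in>QN N. \<bar>f x\<bar> \<le> K"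
proof -
  show "f \<in> borel_measurable (lebesgue_on (QN N))"
    using f by (intro measurable_restrict_space1 measurable_completion)
      (simp add: borel_measurable_continuous_onI)
  have "bounded (f ` {0..real N})"
    by (intro compact_imp_bounded compact_continuous_image continuous_on_subset[OF f]) auto
  then obtain K where "\<forall>x\<in>{0..real N}. \<bar>f x\<bar> \<le> K"
    by (auto simp: bounded_iff)
  thus "\<exists>K\<ge>0. \<forall>x\<in>QN N. \<bar>f x\<bar> \<le> K"
    by (intro exI[of _ "\<bar>K\<bar>"]) (auto simp: QN_def intro: order_trans[OF _ abs_ge_self])
qed

lemma periodic_test_one: "periodic_test N (\<lambda>_. 1)"
proof -
  have "(deriv ^^ n) (\<lambda>_::real. 1::real) = (\<lambda>_. if n = 0 then 1 else 0)" for n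
    by (induction n) auto
  thus ?thesis by (auto simp: periodic_test_def)
qed

text \<open>
Constant functions are smooth and periodic, so they can serve as test functions.
\<close>
lemma H1_per_mean_zero:
  assumes "H1_per N v h"
  shows "(LINT x|lebesgue_on (QN N). h x) = 0"
  using assms periodic_test_one[of N] unfolding H1_per_def by fastforce

text \<open>
The primitive \<open>W x = \<integral>\<^sub>0\<^sup>x g\<close>, continued periodically, has weak derivative \<open>g\<close>. Since \<open>g\<close> is merely
measurable, integration by parts is replaced by exchanging the order of integration over the
triangle \<open>t < x\<close>; the boundary term is \<open>\<phi> N * \<integral>g\<close> and vanishes because \<open>g\<close> has mean zero.
\<close>
lemma H1_per_primitive:
  fixes g :: "real \<Rightarrow> real"
  assumes N: "N > 0"
    and g: "g \<in> borel_measurable (lebesgue_on (QN N))"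
    and b: "\<And>x. x \<in> QN N \<Longrightarrow> \<bar>g x\<bar> \<le> b"
    and mean: "(LINT x|lebesgue_on (QN N). g x) = 0"
  shows "\<exists>w. H1_per N w g"
proof -
  let ?L = "lebesgue_on (QN N)"
  interpret L: finite_measure ?L by (rule finite_measure_QN)
  interpret LL: pair_sigma_finite ?L ?L ..
  interpret LP: finite_measure "?L \<Otimes>\<^sub>M ?L"
    by (rule finite_measure_pair_measure) (rule finite_measure_QN)+
  note g[measurable]
  have id: "(\<lambda>x. x) \<in> ?L \<rightarrow>\<^sub>M borel"
    by (intro measurable_restrict_space1 measurable_completion) simp
  have lt[measurable]: "Measurable.pred (?L \<Otimes>\<^sub>M ?L) (\<lambda>z. snd z < fst z)"
    using measurable_compose[OF measurable_fst id] measurable_compose[OF measurable_snd id]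
    by measurable
  define W where "W x = (LINT t|?L. (if t < x then g t else 0))" for x
  define w where "w x = W (x - real N * \<lfloor>x / real N\<rfloor>)" for x
  have wW: "w x = W x" if "x \<in> QN N" for x
  proof -
    have "0 \<le> x / real N" "x / real N < 1" using that N by (auto simp: QN_def)
    hence "\<lfloor>x / real N\<rfloor> = 0" by linarith
    thus ?thesis by (simp add: w_def)
  qed
  have W_meas: "W \<in> borel_measurable ?L"
  proof -
    have "(\<lambda>z. if snd z < fst z then g (snd z) else 0) \<in> borel_measurable (?L \<Otimes>\<^sub>M ?L)"
      by measurable
    thus ?thesis unfolding W_def
      by (intro L.borel_measurable_lebesgue_integral) (simp add: case_prod_beta)
  qed
  have w_meas: "w \<in> borel_measurable ?L"
    using W_meas by (rule measurable_cong[THEN iffD1, rotated]) (simp add: wW)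
  have b0: "0 \<le> b" using b[of "real N / 2"] N by (force simp: QN_def)
  have w_bd: "\<bar>w x\<bar> \<le> b * real N" if "x \<in> QN N" for x
  proof -
    have "\<bar>W x\<bar> \<le> (LINT t|?L. \<bar>if t < x then g t else 0\<bar>)"
      unfolding W_def by (rule integral_abs_bound)
    also have "\<dots> \<le> (LINT t|?L. b)"
      by (rule integral_mono') (use b b0 in auto)
    also have "\<dots> = b * real N"
      by (simp add: measure_lebesgue_on_QN)
    finally show ?thesis using wW[OF that] by simp
  qed
  have ibp: "(LINT x|?L. w x * deriv \<phi> x) = - (LINT x|?L. g x * \<phi> x)"
    if \<phi>: "periodic_test N \<phi>" for \<phi>
  proof -
    have c: "continuous_on UNIV (deriv \<phi>)"
      by (rule periodic_test_cont_deriv[OF \<phi>])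
    note [measurable] = continuous_measurable_QN[OF c]
    obtain K where K0: "0 \<le> K" and K: "\<And>x. x \<in> QN N \<Longrightarrow> \<bar>deriv \<phi> x\<bar> \<le> K"
      using continuous_bounded_QN[OF c] by blast
    define F where "F x t = (if t < x then g t else 0) * deriv \<phi> x" for x t
    have F_int: "integrable (?L \<Otimes>\<^sub>M ?L) (case_prod F)"
    proof (rule LP.integrable_const_bound[of _ "b * K"])
      show "case_prod F \<in> borel_measurable (?L \<Otimes>\<^sub>M ?L)"
        unfolding F_def case_prod_beta by measurable
      show "AE z in ?L \<Otimes>\<^sub>M ?L. norm (case_prod F z) \<le> b * K"
        using b b0 K K0 by (intro AE_I2)
          (auto simp: F_def space_pair_measure abs_mult intro!: mult_mono)
    qed
    have inner: "(LINT x|?L. F x t) = g t * (\<phi> (real N) - \<phi> t)" if t: "t \<in> QN N" for t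
    proof -
      have t': "0 < t" "t < real N" using t by (auto simp: QN_def)
      have "(LINT x|?L. F x t) = g t * (LINT x|?L. indicator {t<..<real N} x * deriv \<phi> x)"
        by (subst integral_mult_right_zero[symmetric], rule Bochner_Integration.integral_cong)
          (auto simp: F_def QN_def indicator_def)
      also have "(LINT x|?L. indicator {t<..<real N} x * deriv \<phi> x) = 
          (LINT x|lebesgue_on {t<..<real N}. deriv \<phi> x)"
        using t' by (simp add: integral_restrict_space QN_sets, intro Bochner_Integration.integral_cong)
           (auto simp: QN_def indicator_def)
      also have "\<dots> = integral {t<..<real N} (deriv \<phi>)"
      proof (rule lebesgue_integral_eq_integral)
        show "integrable (lebesgue_on {t<..<real N}) (deriv \<phi>)"
          by (rule finite_measure.integrable_const_bound[of _ _ K, OF finite_measure_lebesgue_on])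
            (use K t' c in \<open>auto simp: QN_def bounded_set_imp_lmeasurable
               borel_measurable_continuous_onI
               intro!: AE_I2 measurable_restrict_space1 measurable_completion\<close>)
      qed simp
      also have "\<dots> = integral {t..real N} (deriv \<phi>)"
        by (rule integral_open_interval_real[symmetric])
      also have "\<dots> = \<phi> (real N) - \<phi> t"
        using t' by (intro integral_unique fundamental_theorem_of_calculus)
          (auto intro!: has_field_derivative_at_within[OF periodic_test_deriv[OF \<phi>]]
            simp flip: has_real_derivative_iff_has_vector_derivative)
      finally show ?thesis .
    qed
    have c\<phi>: "continuous_on UNIV \<phi>"
      using periodic_test_deriv[OF \<phi>] by (meson DERIV_isCont continuous_at_imp_continuous_on)
    note [measurable] = continuous_measurable_QN[OF c\<phi>]
    obtain K' where K': "0 \<le> K'" "\<And>x. x \<in> QN N \<Longrightarrow> \<bar>\<phi> x\<bar> \<le> K'"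
      using continuous_bounded_QN[OF c\<phi>] by blast
    have g_int: "integrable ?L g" using g b by (rule integrable_bounded_QN)
    have g\<phi>_int: "integrable ?L (\<lambda>t. g t * \<phi> t)"
      by (rule integrable_bounded_QN[of _ _ "b * K'"]) 
        (use b K' b0 in \<open>auto simp: abs_mult intro!: mult_mono\<close>)
    have "(LINT x|?L. w x * deriv \<phi> x) = (LINT x|?L. (LINT t|?L. F x t))"
      by (intro Bochner_Integration.integral_cong) (auto simp: wW W_def F_def)
    also have "\<dots> = (LINT t|?L. (LINT x|?L. F x t))"
      using LL.Fubini_integral[OF F_int] by simp
    also have "\<dots> = (LINT t|?L. \<phi> (real N) * g t - g t * \<phi> t)"
      by (intro Bochner_Integration.integral_cong) (auto simp: inner algebra_simps)
    also have "\<dots> = - (LINT x|?L. g x * \<phi> x)"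
      using g_int g\<phi>_int by (simp add: mean)
    finally show ?thesis .
  qed
  have per: "w (x + real N) = w x" for x
  proof -
    have "(x + real N) / real N = x / real N + 1" using N by (simp add: field_simps)
    thus ?thesis by (simp add: w_def algebra_simps)
  qed
  have "H1_per N w g"
    unfolding H1_per_def using per ibp L2_bounded[OF w_meas w_bd] L2_bounded[OF g b] by auto
  thus ?thesis by blast
qed

text \<open>
Constant flux \<open>c\<close> means \<open>g = c / a - p\<close>, and the requirement that \<open>g\<close> has mean zero fixes \<open>c\<close>.
This gives a corrector. Instead of showing that correctors are unique, the proof tests the equation
of an arbitrary corrector with \<open>N / a - I\<close>, which has mean zero and so is the derivative of a
periodic function: the result determines the mean flux, which is all that \<open>Hom\<close> records.
\<close>
lemma Hom_harmonic_mean: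
  fixes a :: "real \<Rightarrow> real"
  assumes N: "N > 0"
    and a: "a \<in> borel_measurable (lebesgue_on (QN N))"
    and m: "0 < m" "\<And>x. x \<in> QN N \<Longrightarrow> m \<le> a x"
    and M: "\<And>x. x \<in> QN N \<Longrightarrow> a x \<le> M"
    and I: "I = (LINT x|lebesgue_on (QN N). 1 / a x)" "I > 0"
  shows "Hom N a = real N / I"
proof -
  let ?L = "lebesgue_on (QN N)"
  note a[measurable]
  have pos: "0 < a x" if "x \<in> QN N" for x using m that by force
  have r_bd: "\<bar>1 / a x\<bar> \<le> 1 / m" if "x \<in> QN N" for x
    using m that pos[OF that] by (auto simp: field_simps)
  have r_int: "integrable ?L (\<lambda>x. 1 / a x)"
    by (rule integrable_bounded_QN[OF _ r_bd]) auto
  have const: "(LINT x|?L. c) = c * real N" for c :: real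
    by (simp add: measure_lebesgue_on_QN)
  have const_int: "integrable ?L (\<lambda>x. c)" for c :: real
    by (rule integrable_bounded_QN[of _ _ "\<bar>c\<bar>"]) auto
  define r where "r c p x = c * (1 / a x) - p" for c p x
  have ex: "\<exists>w. H1_per N w (r c p)" if "c * I = p * real N" for c p
  proof (rule H1_per_primitive[OF N])
    show "\<bar>r c p x\<bar> \<le> \<bar>c\<bar> * (1 / m) + \<bar>p\<bar>" if "x \<in> QN N" for x
    proof -
      have "\<bar>r c p x\<bar> \<le> \<bar>c * (1 / a x)\<bar> + \<bar>p\<bar>" unfolding r_def by (rule abs_triangle_ineq4)
      also have "\<bar>c * (1 / a x)\<bar> \<le> \<bar>c\<bar> * (1 / m)"
        unfolding abs_mult by (intro mult_left_mono r_bd that) auto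
      finally show ?thesis by simp
    qed
    show "(LINT x|?L. r c p x) = 0"
    proof -
      have "(LINT x|?L. r c p x) = (LINT x|?L. c * (1 / a x)) - (LINT x|?L. p)"
        unfolding r_def
        by (rule Bochner_Integration.integral_diff[OF integrable_mult_right[OF r_int] const_int])
      also have "(LINT x|?L. c * (1 / a x)) = c * I"
        unfolding I(1) by (rule integral_mult_right_zero)
      finally show ?thesis using that by (simp add: measure_lebesgue_on_QN)
    qed
    show "r c p \<in> borel_measurable ?L" unfolding r_def by measurable
  qed
  have corr: "\<exists>w g. corrector N a p w g" for p
  proof -
    define c where "c = p * real N / I"
    have c: "c * I = p * real N" using I(2) by (simp add: c_def)
    from ex[OF this] obtain w where w: "H1_per N w (r c p)" by blast
    have "(LINT x|?L. a x * (p + r c p x) * h x) = 0" if "H1_per N v h" for v h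
    proof -
      have "(LINT x|?L. a x * (p + r c p x) * h x) = (LINT x|?L. c * h x)"
        by (rule Bochner_Integration.integral_cong) (auto dest: pos simp: r_def)
      thus ?thesis using H1_per_mean_zero[OF that] by simp
    qed
    with w show ?thesis unfolding corrector_def by blast
  qed
  have flux: "(LINT x|?L. a x * (p + g x)) = p * real N * real N / I" 
    if "corrector N a p w g" for p w g
  proof -
    have H: "H1_per N w g" using that by (simp add: corrector_def)
    have gi: "integrable ?L g"
      using H unfolding H1_per_def L2_def
      by (blast intro: finite_measure.square_integrable_imp_integrable[OF finite_measure_QN])
    have [measurable]: "g \<in> borel_measurable ?L" using gi by (rule borel_measurable_integrable)
    (* The upper bound on a is needed so that the flux of an arbitrary corrector is integrable. *)
    have agi: "integrable ?L (\<lambda>x. a x * (p + g x))"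
    proof (rule Bochner_Integration.integrable_bound)
      show "integrable ?L (\<lambda>x. M * \<bar>p + g x\<bar>)"
        using gi const_int by (intro integrable_mult_right integrable_abs) auto
      show "AE x in ?L. norm (a x * (p + g x)) \<le> norm (M * \<bar>p + g x\<bar>)"
      proof (rule AE_I2)
        fix x assume "x \<in> space ?L"
        hence "\<bar>a x\<bar> \<le> \<bar>M\<bar>" using M[of x] pos[of x] by simp
        thus "norm (a x * (p + g x)) \<le> norm (M * \<bar>p + g x\<bar>)"
          by (simp add: abs_mult mult_right_mono)
      qed
    qed measurable
    (* The test derivative is N / a - I. *)
    from ex[of "real N" I] obtain v where "H1_per N v (r (real N) I)" by (auto simp only: mult.commute)
    hence "0 = (LINT x|?L. a x * (p + g x) * r (real N) I x)"
      using that unfolding corrector_def by metis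
    also have "\<dots> = (LINT x|?L. real N * (p + g x) - I * (a x * (p + g x)))"
      by (rule Bochner_Integration.integral_cong) (auto dest: pos simp: r_def field_simps)
    also have "\<dots> = real N * (p * real N) - I * (LINT x|?L. a x * (p + g x))"
    proof -
      have pgi: "integrable ?L (\<lambda>x. p + g x)"
        using gi const_int by (rule Bochner_Integration.integrable_add[rotated])
      have "(LINT x|?L. p + g x) = (LINT x|?L. p) + (LINT x|?L. g x)"
        using const_int gi by (rule Bochner_Integration.integral_add)
      hence "(LINT x|?L. p + g x) = p * real N"
        using H1_per_mean_zero[OF H] const by simp
      thus ?thesis
        using pgi agi by (simp only: Bochner_Integration.integral_diff integrable_mult_right
          integral_mult_right_zero)
    qed
    finally have "I * (LINT x|?L. a x * (p + g x)) = p * real N * real N"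
      by (simp only: mult.assoc mult.commute mult.left_commute)
    thus ?thesis using I(2) by (metis less_irrefl nonzero_mult_div_cancel_left)
  qed
  show ?thesis unfolding Hom_def
  proof (rule the_equality)
    show "\<forall>p. \<exists>w g. corrector N a p w g \<and>
        real N / I * p = 1 / measure lebesgue (QN N) * (LINT x|?L. a x * (p + g x))"
    proof
      fix p
      from corr obtain w g where "corrector N a p w g" by blast
      with flux[OF this] N show "\<exists>w g. corrector N a p w g \<and>
          real N / I * p = 1 / measure lebesgue (QN N) * (LINT x|?L. a x * (p + g x))"
        by (intro exI[of _ w] exI[of _ g]) (simp add: measure_QN)
    qed
  next
    fix s
    assume "\<forall>p. \<exists>w g. corrector N a p w g \<and>
        s * p = 1 / measure lebesgue (QN N) * (LINT x|?L. a x * (p + g x))"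
    then obtain w g where "corrector N a 1 w g"
      "s * 1 = 1 / measure lebesgue (QN N) * (LINT x|?L. a x * (1 + g x))" by blast
    with flux[OF this(1)] N show "s = real N / I" by (simp add: measure_QN)
  qed
qed

section \<open>Effective coefficients of two-phase media\<close>

definition mean_inverse :: "(real \<Rightarrow> real) \<Rightarrow> real" where
  "mean_inverse a = integral {0..1} (\<lambda>x. 1 / a x)"

text \<open>
The harmonic mean of two phases with volume fractions \<open>1 - t\<close> and \<open>t\<close>, expressed through the
mean inverses of the phases.
\<close>
definition mixed_mean :: "real \<Rightarrow> real \<Rightarrow> real \<Rightarrow> real" where
  "mixed_mean \<alpha> \<gamma> t = 1 / (\<alpha> + t * (\<gamma> - \<alpha>))"

lemma admissible_shift:
  assumes "admissible a"
  shows "a (x + real k) = a x"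
proof (induction k)
  case (Suc k)
  have "a (x + real k + 1) = a (x + real k)"
    using assms unfolding admissible_def by blast
  with Suc show ?case by (simp add: add_ac)
qed simp

lemma admissible_inverse_has_integral:
  assumes a: "admissible a"
  shows "((\<lambda>x. 1 / a x) has_integral mean_inverse a) {real k..real k + 1}"
proof -
  obtain \<alpha> \<beta> where b: "\<alpha> > 0" "\<And>x. \<alpha> \<le> a x" "\<And>x. a x \<le> \<beta>"
    and [measurable]: "a \<in> borel_measurable lebesgue"
    using a unfolding admissible_def by blast
  have "integrable (lebesgue_on {0..1}) (\<lambda>x. 1 / a x)"
  proof (rule finite_measure.integrable_const_bound[of _ _ "1 / \<alpha>"])
    show "finite_measure (lebesgue_on {0..1::real})"
      by (rule finite_measure_lebesgue_on) simp
    have "\<bar>1 / a x\<bar> \<le> 1 / \<alpha>" for x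
      using b(1) b(2)[of x] by (simp add: field_simps)
    thus "AE x in lebesgue_on {0..1}. norm (1 / a x) \<le> 1 / \<alpha>" by simp
    show "(\<lambda>x. 1 / a x) \<in> borel_measurable (lebesgue_on {0..1})"
      by (rule measurable_restrict_space1) measurable
  qed
  hence "(\<lambda>x. 1 / a x) integrable_on {0..1}"
    by (rule integrable_on_lebesgue_on) simp
  hence "((\<lambda>x. 1 / a x) has_integral mean_inverse a) {0..1}"
    unfolding mean_inverse_def by (rule integrable_integral)
  moreover have "(\<lambda>x. 1 / a x) \<circ> (+) (real k) = (\<lambda>x. 1 / a x)"
    using admissible_shift[OF a, of _ k] by (auto simp: add.commute)
  ultimately show ?thesis
    using has_integral_shift_Icc_real[of "\<lambda>x. 1 / a x" "real k" "mean_inverse a" 0 1]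
    by (simp add: add.commute)
qed

lemma mean_inverse_pos:
  assumes a: "admissible a"
  shows "mean_inverse a > 0"
proof -
  obtain \<alpha> \<beta> where b: "\<alpha> > 0" "\<And>x. \<alpha> \<le> a x" "\<And>x. a x \<le> \<beta>"
    using a unfolding admissible_def by blast
  have \<beta>: "\<beta> > 0" using b(1) b(2)[of 0] b(3)[of 0] by linarith
  have "1 / \<beta> \<le> 1 / a x" for x
    using b(1) b(2)[of x] b(3)[of x] by (intro divide_left_mono) (auto intro!: mult_pos_pos \<beta>)
  moreover have "((\<lambda>x. 1 / a x) has_integral mean_inverse a) {0..1}"
    using admissible_inverse_has_integral[OF a, of 0] by simp
  ultimately have "1 / \<beta> \<le> mean_inverse a"
    using has_integral_le[OF has_integral_const_real[of "1 / \<beta>" 0 1]] by simp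
  with \<beta> show ?thesis by (meson divide_pos_pos less_le_trans zero_less_one)
qed

lemma cells_eq: "cells N = {0..<int N}"
proof (intro equalityI subsetI)
  fix k assume "k \<in> cells N"
  hence sub: "{real_of_int k<..<real_of_int k + 1} \<subseteq> {0<..<real N}"
    by (simp add: cells_def cell_def QN_def)
  hence "0 \<le> real_of_int k \<and> real_of_int k + 1 \<le> real N"
    by (subst (asm) greaterThanLessThan_subseteq_greaterThanLessThan) auto
  thus "k \<in> {0..<int N}" by (auto; linarith)
next
  fix k assume "k \<in> {0..<int N}"
  hence "0 \<le> real_of_int k \<and> real_of_int k + 1 \<le> real N" by (auto; linarith)
  thus "k \<in> cells N" by (auto simp: cells_def cell_def QN_def)
qed

lemma finite_cells: "finite (cells N)" and card_cells: "card (cells N) = N"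
  by (simp_all add: cells_eq)

lemma cell_disjoint: "x \<in> cell j \<Longrightarrow> x \<in> cell k \<longleftrightarrow> k = j"
  by (auto simp: cell_def)

text \<open>
The intervals \<open>cell k\<close> are open, so on the integers the mixture takes the value of \<open>A\<close>
irrespective of \<open>K\<close>; Henstock-Kurzweil integration over closed unit intervals is insensitive to
these endpoints and adds up along the line.
\<close>
lemma mixture_inverse_has_integral:
  assumes A: "admissible A" and C: "admissible C"
  shows "((\<lambda>x. 1 / (A x + indicator (\<Union>k\<in>K. cell k) x * (C x - A x)))
    has_integral (\<Sum>k\<in>{0..<int N}. if k \<in> K then mean_inverse C else mean_inverse A))
      {0..real N}" (is "(?f has_integral _) _")
proof (induction N)
  case 0
  show ?case by (simp add: has_integral_refl)
next
  case (Suc N)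
  let ?a = "if int N \<in> K then C else A"
  have "((\<lambda>x. 1 / ?a x) has_integral mean_inverse ?a) (cbox (real N) (real N + 1))"
    unfolding box_real by (rule admissible_inverse_has_integral) (simp add: A C)
  hence "(?f has_integral mean_inverse ?a) (cbox (real N) (real N + 1))"
  proof (rule has_integral_spike_interior)
    fix x assume "x \<in> box (real N) (real N + 1)"
    hence x: "x \<in> cell (int N)" by (simp add: cell_def)
    have "x \<in> (\<Union>k\<in>K. cell k) \<longleftrightarrow> int N \<in> K" by (simp add: cell_disjoint[OF x])
    thus "?f x = 1 / ?a x" by (simp add: indicator_def)
  qed
  hence "(?f has_integral (\<Sum>k\<in>{0..<int N}. if k \<in> K then mean_inverse C else mean_inverse A)
      + mean_inverse ?a) {0..real N + 1}"
    by (intro has_integral_combine[OF _ _ Suc.IH]) simp_all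
  moreover have "{0..<int (Suc N)} = insert (int N) {0..<int N}" by auto
  ultimately show ?case by (cases "int N \<in> K") (simp_all add: add.commute)
qed

lemma sum_indicator_card:
  "finite S \<Longrightarrow> (\<Sum>k\<in>S. indicator K k) = real (card (K \<inter> S))"
  by (simp add: indicator_def sum.If_cases Int_commute)

text \<open>
The periodic medium \<open>A\<close>, its perturbations by one or two defects, and the random medium are all of
this form for a suitable set \<open>K\<close>. The set may be infinite, as it is for a random configuration, because only the cells inside \<open>QN N\<close> count.
\<close>
lemma Hom_mixture:
  assumes A: "admissible A" and C: "admissible C" and N: "N > 0"
  shows "Hom N (\<lambda>x. A x + indicator (\<Union>k\<in>K. cell k) x * (C x - A x)) =
    mixed_mean (mean_inverse A) (mean_inverse C) (real (card (K \<inter> cells N)) / real N)"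
    (is "Hom N ?a = _")
proof -
  let ?\<alpha> = "mean_inverse A" and ?\<gamma> = "mean_inverse C" and ?n = "card (K \<inter> cells N)"
  let ?I = "\<Sum>k\<in>cells N. if k \<in> K then ?\<gamma> else ?\<alpha>"
  obtain \<alpha> \<beta> where b: "\<alpha> > 0" "\<And>x. \<alpha> \<le> A x" "\<And>x. A x \<le> \<beta>"
    and [measurable]: "A \<in> borel_measurable lebesgue"
    using A unfolding admissible_def by blast
  obtain \<alpha>' \<beta>' where b': "\<alpha>' > 0" "\<And>x. \<alpha>' \<le> C x" "\<And>x. C x \<le> \<beta>'"
    and [measurable]: "C \<in> borel_measurable lebesgue"
    using C unfolding admissible_def by blast
  have "open (\<Union>k\<in>K. cell k)" by (auto simp: cell_def)
  hence [measurable]: "(\<Union>k\<in>K. cell k) \<in> sets lebesgue"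
    by (intro sets_completionI_sets) simp
  have meas: "?a \<in> borel_measurable (lebesgue_on (QN N))"
    by (rule measurable_restrict_space1) measurable
  have lower: "min \<alpha> \<alpha>' \<le> ?a x" and upper: "?a x \<le> max \<beta> \<beta>'" for x
    using b(2,3)[of x] b'(2,3)[of x] by (auto simp: indicator_def)
  have pos: "0 < min \<alpha> \<alpha>'" using b b' by simp
  have I_pos: "0 < ?I"
    using N mean_inverse_pos[OF A] mean_inverse_pos[OF C]
    by (intro sum_pos finite_cells) (auto simp: cells_eq)
  have "integrable (lebesgue_on (QN N)) (\<lambda>x. 1 / ?a x)"
  proof (rule integrable_bounded_QN)
    show "\<bar>1 / ?a x\<bar> \<le> 1 / min \<alpha> \<alpha>'" for x
    proof -
      have "0 < ?a x" using pos lower[of x] by linarith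
      moreover have "1 / ?a x \<le> 1 / min \<alpha> \<alpha>'"
        using pos lower[of x] calculation by (intro divide_left_mono mult_pos_pos) auto
      ultimately show ?thesis by simp
    qed
  qed (use meas in measurable)
  hence "(LINT x|lebesgue_on (QN N). 1 / ?a x) = integral (QN N) (\<lambda>x. 1 / ?a x)"
    by (rule lebesgue_integral_eq_integral[OF _ QN_sets])
  also have "\<dots> = integral {0..real N} (\<lambda>x. 1 / ?a x)"
    unfolding QN_def by (rule integral_open_interval_real[symmetric])
  also have "\<dots> = ?I"
    using mixture_inverse_has_integral[OF A C, of K N] unfolding cells_eq by (rule integral_unique)
  finally have I: "?I = (LINT x|lebesgue_on (QN N). 1 / ?a x)" by simp
  have "Hom N ?a = real N / ?I"
    by (rule Hom_harmonic_mean[OF N meas pos lower upper I I_pos])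
  also have "?I = (\<Sum>k\<in>cells N. ?\<alpha> + indicator K k * (?\<gamma> - ?\<alpha>))"
    by (intro sum.cong) (auto simp: indicator_def)
  also have "\<dots> = real N * ?\<alpha> + real ?n * (?\<gamma> - ?\<alpha>)"
    by (simp add: sum.distrib card_cells sum_indicator_card finite_cells flip: sum_distrib_right)
  also have "real N / \<dots> = mixed_mean ?\<alpha> ?\<gamma> (real ?n / real N)"
    using N unfolding mixed_mean_def by (simp add: field_simps)
  finally show ?thesis .
qed

text \<open>
The parameter \<open>\<gamma>\<close> is free because the volume fraction is zero; this lets the periodic coefficient be
compared with the value at \<open>0\<close> of any mixing law with first phase \<open>A\<close>.
\<close>
lemma per_star_eq:
  assumes "admissible A"
  shows "per_star A = mixed_mean (mean_inverse A) \<gamma> 0"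
  using Hom_mixture[OF assms assms, of 1 "{}"] by (simp add: per_star_def mixed_mean_def)

lemma A1_star_eq:
  assumes "admissible A" "admissible C" "k \<in> cells N"
  shows "A1_star A C N k = mixed_mean (mean_inverse A) (mean_inverse C) (1 / real N)"
proof -
  have "N > 0" using assms by (simp add: cells_eq)
  thus ?thesis
    using Hom_mixture[of A C N "{k}"] assms by (simp add: A1_star_def)
qed

lemma A2_star_eq:
  assumes "admissible A" "admissible C" "k \<in> cells N" "l \<in> cells N" "k \<noteq> l"
  shows "A2_star A C N k l = mixed_mean (mean_inverse A) (mean_inverse C) (2 / real N)"
proof -
  have "N > 0" using assms by (simp add: cells_eq)
  moreover have "cell k \<inter> cell l = {}" using assms(5) by (auto simp: cell_disjoint)
  hence "indicator (\<Union>j\<in>{k, l}. cell j) x = indicator (cell k) x + (indicator (cell l) x :: real)" for x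
    by (auto simp: indicator_def)
  moreover have "card ({k, l} \<inter> cells N) = 2" using assms by simp
  ultimately show ?thesis
    using Hom_mixture[of A C N "{k, l}"] assms by (simp add: A2_star_def)
qed

lemma A_star_eq:
  assumes A: "admissible A" "admissible C" and N: "N > 0"
    and B: "\<And>k. B k \<omega> \<in> {0, 1}"
  shows "A_star A C B N \<omega> =
    mixed_mean (mean_inverse A) (mean_inverse C) ((\<Sum>k\<in>cells N. B k \<omega>) / real N)"
proof -
  let ?K = "{k. B k \<omega> = 1}"
  have "(\<Sum>\<^sub>\<infinity>k\<in>UNIV. indicator (cell k) x * B k \<omega>) = indicator (\<Union>k\<in>?K. cell k) x" for x
  proof (cases "\<exists>j. x \<in> cell j")
    case True
    then obtain j where j: "x \<in> cell j" by blast
    have "(\<Sum>\<^sub>\<infinity>k\<in>UNIV. indicator (cell k) x * B k \<omega>) = 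
        (\<Sum>\<^sub>\<infinity>k\<in>{j}. indicator (cell k) x * B k \<omega>)"
      by (rule infsum_cong_neutral) (auto simp: cell_disjoint[OF j] indicator_def)
    also have "\<dots> = indicator (\<Union>k\<in>?K. cell k) x"
      using B[of j] j by (auto simp: indicator_def cell_disjoint[OF j])
    finally show ?thesis .
  qed (auto simp: indicator_def)
  hence "A_star A C B N \<omega> =
      mixed_mean (mean_inverse A) (mean_inverse C) (real (card (?K \<inter> cells N)) / real N)"
    using Hom_mixture[OF A N, of ?K] by (simp add: A_star_def A_eta_def[abs_def])
  also have "real (card (?K \<inter> cells N)) = (\<Sum>k\<in>cells N. indicator ?K k)"
    by (simp add: sum_indicator_card finite_cells)
  also have "\<dots> = (\<Sum>k\<in>cells N. B k \<omega>)"
    using B by (intro sum.cong) (auto simp: indicator_def)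
  finally show ?thesis .
qed

section \<open>Closest points in finite-dimensional subspaces\<close>

definition square_integrable :: "'a measure \<Rightarrow> ('a \<Rightarrow> real) set" where
  "square_integrable M = {f. f \<in> borel_measurable M \<and> integrable M (\<lambda>x. (f x)\<^sup>2)}"

lemma square_integrable_mult:
  assumes f: "f \<in> square_integrable M" and g: "g \<in> square_integrable M"
  shows "integrable M (\<lambda>x. f x * g x)"
proof (rule Bochner_Integration.integrable_bound)
  show "integrable M (\<lambda>x. (f x)\<^sup>2 + (g x)\<^sup>2)"
    using f g by (simp add: square_integrable_def)
  have "\<bar>f x * g x\<bar> \<le> (f x)\<^sup>2 + (g x)\<^sup>2" for x
  proof -
    have "2 * (\<bar>f x\<bar> * \<bar>g x\<bar>) \<le> (f x)\<^sup>2 + (g x)\<^sup>2"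
      using sum_squares_bound[of "\<bar>f x\<bar>" "\<bar>g x\<bar>"] by simp
    moreover have "0 \<le> \<bar>f x\<bar> * \<bar>g x\<bar>" by simp
    ultimately show ?thesis unfolding abs_mult by linarith
  qed
  thus "AE x in M. norm (f x * g x) \<le> norm ((f x)\<^sup>2 + (g x)\<^sup>2)" by simp
  show "(\<lambda>x. f x * g x) \<in> borel_measurable M"
    using f g by (auto simp: square_integrable_def intro: borel_measurable_times)
qed

lemma square_integrable_lincomb:
  assumes f: "f \<in> square_integrable M" and g: "g \<in> square_integrable M"
  shows "(\<lambda>x. f x + t * g x) \<in> square_integrable M"
proof -
  have [measurable]: "f \<in> borel_measurable M" "g \<in> borel_measurable M"
    using f g by (simp_all add: square_integrable_def)
  have "integrable M (\<lambda>x. (f x)\<^sup>2 + 2 * t * (f x * g x) + t\<^sup>2 * (g x)\<^sup>2)"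
    using f g square_integrable_mult[OF f g] by (simp add: square_integrable_def)
  moreover have "(\<lambda>x. (f x)\<^sup>2 + 2 * t * (f x * g x) + t\<^sup>2 * (g x)\<^sup>2) = (\<lambda>x. (f x + t * g x)\<^sup>2)"
    by (auto simp: power2_eq_square algebra_simps)
  ultimately show ?thesis by (simp add: square_integrable_def)
qed

text \<open>
A linear space of square integrable functions onto which every square integrable function has an
orthogonal projection. The projections are required for all functions, not only for one, so that
the property survives the adjunction of a further function.
\<close>
definition admits_projections :: "'a measure \<Rightarrow> ('a \<Rightarrow> real) set \<Rightarrow> bool" where
  "admits_projections M V \<longleftrightarrow> V \<subseteq> square_integrable M \<and>
     (\<forall>u\<in>V. \<forall>v\<in>V. \<forall>t. (\<lambda>x. u x + t * v x) \<in> V) \<and>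
     (\<forall>f\<in>square_integrable M. \<exists>v\<in>V. \<forall>u\<in>V. (LINT x|M. (f x - v x) * u x) = 0)"

lemma admits_projections_zero: "admits_projections M {\<lambda>_. 0}"
  by (auto simp: admits_projections_def square_integrable_def)

definition add_line :: "('a \<Rightarrow> real) \<Rightarrow> ('a \<Rightarrow> real) set \<Rightarrow> ('a \<Rightarrow> real) set" where
  "add_line y V = {\<lambda>x. v x + t * y x | v t. v \<in> V}"

lemma add_lineI: "v \<in> V \<Longrightarrow> (\<lambda>x. v x + t * y x) \<in> add_line y V"
  by (auto simp: add_line_def)

lemma add_lineE:
  assumes "w \<in> add_line y V"
  obtains v t where "v \<in> V" "w = (\<lambda>x. v x + t * y x)"
  using assms by (auto simp: add_line_def)

text \<open>
One step of the Gram-Schmidt procedure: only the component \<open>r\<close> of \<open>y\<close> orthogonal to \<open>V\<close> has to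
be added. If \<open>r\<close> vanishes almost everywhere, the quotient defining the coefficient \<open>t\<close> is \<open>0\<close>,
which is then a correct choice.
\<close>
lemma admits_projections_add_line:
  assumes V: "admits_projections M V" and y: "y \<in> square_integrable M"
  shows "admits_projections M (add_line y V)" (is "admits_projections M ?W")
  unfolding admits_projections_def
proof (intro conjI ballI allI)
  have V_sq: "V \<subseteq> square_integrable M"
    and V_lin: "\<And>u v t. u \<in> V \<Longrightarrow> v \<in> V \<Longrightarrow> (\<lambda>x. u x + t * v x) \<in> V"
    and V_proj: "\<And>f. f \<in> square_integrable M \<Longrightarrow>
      \<exists>v\<in>V. \<forall>u\<in>V. (LINT x|M. (f x - v x) * u x) = 0"
    using V by (auto simp: admits_projections_def)
  show "?W \<subseteq> square_integrable M"
  proof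
    fix w assume "w \<in> ?W"
    then obtain v t where "v \<in> V" and w: "w = (\<lambda>x. v x + t * y x)" by (rule add_lineE)
    hence "v \<in> square_integrable M" using V_sq by blast
    thus "w \<in> square_integrable M" unfolding w by (rule square_integrable_lincomb[OF _ y])
  qed
  show "(\<lambda>x. u x + t * w x) \<in> ?W" if uw: "u \<in> ?W" "w \<in> ?W" for u w t
  proof -
    from uw obtain u' s w' r where mem: "u' \<in> V" "w' \<in> V"
      and eq: "u = (\<lambda>x. u' x + s * y x)" "w = (\<lambda>x. w' x + r * y x)"
      by (elim add_lineE) blast
    have "(\<lambda>x. (u' x + t * w' x) + (s + t * r) * y x) \<in> ?W"
      by (rule add_lineI[OF V_lin[OF mem]])
    thus ?thesis by (simp add: eq algebra_simps)
  qed
  fix f assume f: "f \<in> square_integrable M"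
  obtain p where p: "p \<in> V" "\<And>u. u \<in> V \<Longrightarrow> (LINT x|M. (f x - p x) * u x) = 0"
    using V_proj[OF f] by blast
  obtain q where q: "q \<in> V" "\<And>u. u \<in> V \<Longrightarrow> (LINT x|M. (y x - q x) * u x) = 0"
    using V_proj[OF y] by blast
  (* Remainders of f and of y after projection onto V. *)
  define g r where "g x = f x + -1 * p x" and "r x = y x + -1 * q x" for x
  have g: "g \<in> square_integrable M" and r: "r \<in> square_integrable M"
    unfolding g_def r_def
    by (rule square_integrable_lincomb[OF f], use p(1) V_sq in blast)
      (rule square_integrable_lincomb[OF y], use q(1) V_sq in blast)
  define t where "t = (LINT x|M. g x * r x) / (LINT x|M. (r x)\<^sup>2)"
  have t: "(LINT x|M. g x * r x) = t * (LINT x|M. (r x)\<^sup>2)"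
  proof (cases "(LINT x|M. (r x)\<^sup>2) = 0")
    case True
    hence "AE x in M. (r x)\<^sup>2 = 0"
      using r by (subst (asm) integral_nonneg_eq_0_iff_AE) (auto simp: square_integrable_def)
    hence "(LINT x|M. g x * r x) = (LINT x|M. 0)"
      using r g by (intro integral_cong_AE) (auto simp: square_integrable_def)
    with True show ?thesis by simp
  qed (simp add: t_def)
  define e where "e x = g x + (- t) * r x" for x
  have e: "e \<in> square_integrable M"
    using g r unfolding e_def by (rule square_integrable_lincomb)
  have e_V: "(LINT x|M. e x * u x) = 0" if u: "u \<in> V" for u
  proof -
    have "u \<in> square_integrable M" using u V_sq by blast
    note i = square_integrable_mult[OF g this] square_integrable_mult[OF r this]
    have "(LINT x|M. e x * u x) = (LINT x|M. g x * u x - t * (r x * u x))"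
      unfolding e_def by (simp add: algebra_simps)
    also have "\<dots> = (LINT x|M. g x * u x) - t * (LINT x|M. r x * u x)"
      using i by simp
    finally show ?thesis using p(2)[OF u] q(2)[OF u] by (simp add: g_def r_def)
  qed
  have e_r: "(LINT x|M. e x * r x) = 0"
  proof -
    have "(LINT x|M. e x * r x) = (LINT x|M. g x * r x - t * (r x)\<^sup>2)"
      unfolding e_def by (simp add: algebra_simps power2_eq_square)
    also have "\<dots> = (LINT x|M. g x * r x) - t * (LINT x|M. (r x)\<^sup>2)"
      using square_integrable_mult[OF g r] r by (simp add: square_integrable_def)
    finally show ?thesis using t by simp
  qed
  show "\<exists>w\<in>?W. \<forall>u\<in>?W. (LINT x|M. (f x - w x) * u x) = 0"
  proof (intro bexI[of _ "\<lambda>x. (p x + (- t) * q x) + t * y x"] ballI)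
    fix u assume "u \<in> ?W"
    then obtain v s where v: "v \<in> V" and u: "u = (\<lambda>x. v x + s * y x)"
      by (rule add_lineE)
    have v': "(\<lambda>x. v x + s * q x) \<in> V" using v q(1) by (rule V_lin)
    have "(LINT x|M. (f x - (p x + (- t) * q x + t * y x)) * u x) =
        (LINT x|M. e x * (v x + s * q x) + s * (e x * r x))"
      by (intro Bochner_Integration.integral_cong) (auto simp: u e_def g_def r_def algebra_simps)
    also have "\<dots> = (LINT x|M. e x * (v x + s * q x)) + s * (LINT x|M. e x * r x)"
      using square_integrable_mult[OF e] v' V_sq r by (subst Bochner_Integration.integral_add) auto
    finally show "(LINT x|M. (f x - (p x + (- t) * q x + t * y x)) * u x) = 0"
      using e_V[OF v'] e_r by simp
  next
    show "(\<lambda>x. (p x + (- t) * q x) + t * y x) \<in> ?W"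
      by (rule add_lineI[OF V_lin[OF p(1) q(1)]])
  qed
qed

text \<open>
Pythagoras: the error of the projection is orthogonal to the difference of two elements of \<open>V\<close>.
\<close>
lemma admits_projections_best_approximation:
  assumes V: "admits_projections M V" and f: "f \<in> square_integrable M"
  shows "\<exists>v\<in>V. \<forall>u\<in>V. (LINT x|M. (f x - v x)\<^sup>2) \<le> (LINT x|M. (f x - u x)\<^sup>2)"
proof -
  obtain v where v: "v \<in> V" "\<And>u. u \<in> V \<Longrightarrow> (LINT x|M. (f x - v x) * u x) = 0"
    using V f unfolding admits_projections_def by blast
  have "(LINT x|M. (f x - v x)\<^sup>2) \<le> (LINT x|M. (f x - u x)\<^sup>2)" if u: "u \<in> V" for u
  proof -
    define e w where "e x = f x + -1 * v x" and "w x = v x + -1 * u x" for x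
    have w_V: "w \<in> V" using V v(1) u unfolding admits_projections_def w_def by blast
    have sub: "V \<subseteq> square_integrable M" using V by (simp add: admits_projections_def)
    have w: "w \<in> square_integrable M" using sub w_V by blast
    have e: "e \<in> square_integrable M"
      unfolding e_def using f by (rule square_integrable_lincomb) (use sub v(1) in blast)
    have "(LINT x|M. (e x)\<^sup>2) + 0 \<le> (LINT x|M. (e x)\<^sup>2) + (LINT x|M. (w x)\<^sup>2)"
      by (intro add_left_mono integral_nonneg) auto
    also have "\<dots> = (LINT x|M. (e x)\<^sup>2) + (LINT x|M. (w x)\<^sup>2) + 2 * (LINT x|M. e x * w x)"
      using v(2)[OF w_V] by (simp add: e_def)
    also have "\<dots> = (LINT x|M. (e x)\<^sup>2 + (w x)\<^sup>2 + 2 * (e x * w x))"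
      using e w square_integrable_mult[OF e w] by (simp add: square_integrable_def)
    also have "\<dots> = (LINT x|M. (f x - u x)\<^sup>2)"
      by (intro Bochner_Integration.integral_cong)
        (auto simp: e_def w_def power2_eq_square algebra_simps)
    finally show ?thesis by (simp add: e_def)
  qed
  with v(1) show ?thesis by blast
qed

text \<open>
After centering all variables, the variance becomes a squared \<open>L\<^sup>2\<close> distance.
\<close>
lemma (in prob_space) variance_minimizer:
  assumes f: "f \<in> square_integrable M"
    and y: "y1 \<in> square_integrable M" "y2 \<in> square_integrable M" "y3 \<in> square_integrable M"
  shows "\<exists>c1 c2 c3. \<forall>d1 d2 d3.
    variance (\<lambda>x. f x - c1 * y1 x - c2 * y2 x - c3 * y3 x) \<le>
    variance (\<lambda>x. f x - d1 * y1 x - d2 * y2 x - d3 * y3 x)"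
proof -
  define cent where "cent g x = g x - expectation g" for g :: "'a \<Rightarrow> real" and x
  have int: "integrable M g" if "g \<in> square_integrable M" for g
    using that unfolding square_integrable_def by (auto intro!: square_integrable_imp_integrable[of g])
  have "(\<lambda>_. 1) \<in> square_integrable M"
    by (simp add: square_integrable_def)
  hence sq: "cent g \<in> square_integrable M" if "g \<in> square_integrable M" for g
    using square_integrable_lincomb[OF that, of "\<lambda>_. 1" "- expectation g"]
    by (simp add: cent_def[abs_def])
  let ?c = "\<lambda>c1 c2 c3 x. ((0 + c1 * cent y1 x) + c2 * cent y2 x) + c3 * cent y3 x"
  let ?V = "add_line (cent y3) (add_line (cent y2) (add_line (cent y1) {\<lambda>_. 0}))"
  have mem: "?c c1 c2 c3 \<in> ?V" for c1 c2 c3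
    by (intro add_lineI) simp
  have "admits_projections M ?V"
    by (intro admits_projections_add_line admits_projections_zero sq y)
  from admits_projections_best_approximation[OF this sq[OF f]] obtain v where v: "v \<in> ?V"
    and best: "\<And>u. u \<in> ?V \<Longrightarrow> (LINT x|M. (cent f x - v x)\<^sup>2) \<le> (LINT x|M. (cent f x - u x)\<^sup>2)"
    by blast
  from v obtain c1 c2 c3 where "v = ?c c1 c2 c3" by (auto elim!: add_lineE)
  hence c: "(LINT x|M. (cent f x - ?c c1 c2 c3 x)\<^sup>2) \<le> (LINT x|M. (cent f x - ?c d1 d2 d3 x)\<^sup>2)"
    for d1 d2 d3 using best[OF mem, of d1 d2 d3] by simp
  have var_eq: "variance (\<lambda>x. f x - d1 * y1 x - d2 * y2 x - d3 * y3 x) =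
     (LINT x|M. (cent f x - ?c d1 d2 d3 x)\<^sup>2)"
    for d1 d2 d3
  proof -
    have "expectation (\<lambda>x. f x - d1 * y1 x - d2 * y2 x - d3 * y3 x) =
      expectation f - d1 * expectation y1 - d2 * expectation y2 - d3 * expectation y3"
      using int[OF f] int[OF y(1)] int[OF y(2)] int[OF y(3)] by simp
    thus ?thesis unfolding cent_def by (simp only:) (simp add: diff_diff_eq algebra_simps)
  qed
  show ?thesis
    by (rule exI[of _ c1], rule exI[of _ c2], rule exI[of _ c3]) (unfold var_eq, intro allI c)
qed

section \<open>Moments of Bernoulli sums\<close>

lemma bernoulli_iidD:
  assumes "prob_space M" "bernoulli_iid M \<eta> B"
  shows bernoulli_measurable: "B k \<in> borel_measurable M"
    and bernoulli_values: "\<omega> \<in> space M \<Longrightarrow> B k \<omega> \<in> {0, 1}"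
    and bernoulli_expectation: "prob_space.expectation M (B k) = \<eta>"
    and bernoulli_indep: "prob_space.indep_vars M (\<lambda>_. borel) B UNIV"
proof -
  interpret prob_space M by fact
  show indep: "indep_vars (\<lambda>_. borel) B UNIV"
    and val: "\<omega> \<in> space M \<Longrightarrow> B k \<omega> \<in> {0, 1}" for \<omega>
    using assms by (simp_all add: bernoulli_iid_def)
  show [measurable]: "B k \<in> borel_measurable M"
    using indep by (simp add: indep_vars_def)
  have "expectation (B k) = expectation (indicator {\<omega>\<in>space M. B k \<omega> = 1})"
    using assms by (intro Bochner_Integration.integral_cong)
      (auto simp: bernoulli_iid_def indicator_def)
  also have "\<dots> = prob {\<omega>\<in>space M. B k \<omega> = 1}"
  proof -
    have "{\<omega>\<in>space M. B k \<omega> = 1} \<inter> space M = {\<omega>\<in>space M. B k \<omega> = 1}" by blast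
    thus ?thesis by simp
  qed
  also have "\<dots> = \<eta>" using assms by (simp add: bernoulli_iid_def)
  finally show "expectation (B k) = \<eta>" .
qed

lemma power_le_fact_exp:
  fixes x :: real
  assumes "x \<ge> 0"
  shows "x ^ n \<le> fact n * exp x"
proof -
  have "(\<Sum>i\<in>{n}. inverse (fact i) * x ^ i) \<le> (\<Sum>i. inverse (fact i) * x ^ i)"
    using assms by (intro sum_le_suminf summable_exp) auto
  also have "\<dots> = exp x" by (simp add: exp_def scaleR_conv_of_real)
  finally show ?thesis by (simp add: field_simps)
qed

lemma even_power_le_fact_exp:
  fixes x :: real
  shows "x ^ (2 * m) \<le> fact (2 * m) * (exp x + exp (- x))"
proof -
  have "x ^ (2 * m) = \<bar>x\<bar> ^ (2 * m)" by (simp add: power_mult)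
  also have "\<dots> \<le> fact (2 * m) * exp \<bar>x\<bar>" by (rule power_le_fact_exp) simp
  also have "\<dots> \<le> fact (2 * m) * (exp x + exp (- x))"
    by (intro mult_left_mono) (auto simp: abs_if)
  finally show ?thesis .
qed

text \<open>
Independence turns the exponential moment of the sum into a product, and Hoeffding's lemma bounds
each factor.
\<close>
lemma (in indep_interval_bounded_random_variables) exp_moment_le:
  assumes l: "l > 0"
  shows "(\<integral>\<^sup>+x. exp (l * (\<Sum>i\<in>I. X i x - expectation (X i))) \<partial>M) \<le>
    ennreal (exp (l\<^sup>2 * (\<Sum>i\<in>I. (b i - a i)\<^sup>2) / 8))"
proof -
  have "(\<integral>\<^sup>+x. exp (l * (\<Sum>i\<in>I. X i x - expectation (X i))) \<partial>M) =
      (\<integral>\<^sup>+x. (\<Prod>i\<in>I. ennreal (exp (l * (X i x - expectation (X i))))) \<partial>M)"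
    by (intro nn_integral_cong) (simp_all add: sum_distrib_left exp_sum fin prod_ennreal)
  also have "\<dots> = (\<Prod>i\<in>I. \<integral>\<^sup>+x. ennreal (exp (l * (X i x - expectation (X i)))) \<partial>M)"
    by (intro indep_vars_nn_integral fin indep_vars_compose2[OF indep]) auto
  also have "\<dots> \<le> (\<Prod>i\<in>I. ennreal (exp (l\<^sup>2 * (b i - a i)\<^sup>2 / 8)))"
  proof (intro prod_mono_ennreal)
    fix i assume i: "i \<in> I"
    from i interpret interval_bounded_random_variable M "X i" "a i" "b i" ..
    show "(\<integral>\<^sup>+x. ennreal (exp (l * (X i x - expectation (X i)))) \<partial>M) \<le>
        ennreal (exp (l\<^sup>2 * (b i - a i)\<^sup>2 / 8))"
      by (rule Hoeffdings_lemma_nn_integral) fact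
  qed
  also have "\<dots> = ennreal (exp (l\<^sup>2 * (\<Sum>i\<in>I. (b i - a i)\<^sup>2) / 8))"
    by (simp add: prod_ennreal sum_divide_distrib sum_distrib_left exp_sum fin)
  finally show ?thesis .
qed

text \<open>
At scale \<open>l = 1 / sqrt n\<close>, where \<open>n\<close> is the number of summands, the exponential moments of both
signs are bounded independently of \<open>n\<close>, and they dominate the even power \<open>(l * T) ^ (2 * m)\<close> of the
centered sum \<open>T\<close>.
\<close>
lemma bernoulli_even_moment:
  assumes M: "prob_space M" and B: "bernoulli_iid M \<eta> B"
    and K: "finite K" "K \<noteq> {}"
  shows "prob_space.expectation M (\<lambda>\<omega>. (\<Sum>k\<in>K. B k \<omega> - \<eta>) ^ (2 * m)) \<le>
    2 * fact (2 * m) * exp (1 / 8) * real (card K) ^ m"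
proof -
  interpret prob_space M by fact
  note [measurable] = bernoulli_measurable[OF M B]
  have val: "B k \<omega> \<in> {0, 1}" if "\<omega> \<in> space M" for k \<omega>
    using bernoulli_values[OF M B that] .
  have indep: "indep_vars (\<lambda>_. borel) B K"
    using bernoulli_indep[OF M B] by (rule indep_vars_subset) simp
  interpret pos: indep_interval_bounded_random_variables M K B "\<lambda>_. 0" "\<lambda>_. 1"
  proof unfold_locales
    show "AE \<omega> in M. B k \<omega> \<in> {0..1}" for k
    proof (rule AE_I2)
      show "B k \<omega> \<in> {0..1}" if "\<omega> \<in> space M" for \<omega>
        using val[OF that, of k] by auto
    qed
  qed (use K indep in auto)
  interpret neg: indep_interval_bounded_random_variables M K "\<lambda>k \<omega>. - B k \<omega>" "\<lambda>_. - 1" "\<lambda>_. 0"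
  proof unfold_locales
    show "indep_vars (\<lambda>_. borel) (\<lambda>k \<omega>. - B k \<omega>) K"
      by (rule indep_vars_compose2[OF indep]) simp
    show "AE \<omega> in M. - B k \<omega> \<in> {- 1..0}" for k
    proof (rule AE_I2)
      show "- B k \<omega> \<in> {- 1..0}" if "\<omega> \<in> space M" for \<omega>
        using val[OF that, of k] by auto
    qed
  qed (use K in auto)
  define n where "n = real (card K)"
  define T where "T \<omega> = (\<Sum>k\<in>K. B k \<omega> - \<eta>)" for \<omega>
  (* The scale at which Hoeffding's bound l^2 n / 8 becomes the constant 1 / 8. *)
  define l where "l = 1 / sqrt n"
  have n: "n > 0" using K by (simp add: n_def card_gt_0_iff)
  have l: "l > 0" "l\<^sup>2 = 1 / n" using n by (simp_all add: l_def power_divide)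
  have T_meas[measurable]: "T \<in> borel_measurable M" unfolding T_def by measurable
  have exp_pos: "(\<integral>\<^sup>+\<omega>. exp (l * T \<omega>) \<partial>M) \<le> ennreal (exp (1 / 8))"
    using pos.exp_moment_le[OF l(1)] l(2) n
    by (simp add: bernoulli_expectation[OF M B] T_def n_def)
  have exp_neg: "(\<integral>\<^sup>+\<omega>. exp (- (l * T \<omega>)) \<partial>M) \<le> ennreal (exp (1 / 8))"
  proof -
    have "(\<Sum>k\<in>K. - B k \<omega> - - \<eta>) = - T \<omega>" for \<omega>
      unfolding T_def by (simp add: sum_subtractf sum_negf)
    thus ?thesis
      using neg.exp_moment_le[OF l(1)] l(2) n
      by (simp add: bernoulli_expectation[OF M B] n_def)
  qed
  have "ennreal (expectation (\<lambda>\<omega>. (l * T \<omega>) ^ (2 * m))) \<le> (\<integral>\<^sup>+\<omega>. (l * T \<omega>) ^ (2 * m) \<partial>M)"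
  proof (cases "integrable M (\<lambda>\<omega>. (l * T \<omega>) ^ (2 * m))")
    case True
    thus ?thesis by (subst nn_integral_eq_integral) (auto simp: power_mult)
  qed (simp add: not_integrable_integral_eq)
  also have "\<dots> \<le> (\<integral>\<^sup>+\<omega>. ennreal (fact (2 * m)) *
      (ennreal (exp (l * T \<omega>)) + ennreal (exp (- (l * T \<omega>)))) \<partial>M)"
    by (intro nn_integral_mono)
      (simp add: even_power_le_fact_exp ennreal_leI flip: ennreal_plus ennreal_mult)
  also have "\<dots> = ennreal (fact (2 * m)) *
      ((\<integral>\<^sup>+\<omega>. exp (l * T \<omega>) \<partial>M) + (\<integral>\<^sup>+\<omega>. exp (- (l * T \<omega>)) \<partial>M))"
    by (simp add: nn_integral_cmult nn_integral_add)
  also have "\<dots> \<le> ennreal (fact (2 * m)) * (ennreal (exp (1 / 8)) + ennreal (exp (1 / 8)))"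
    by (intro mult_left_mono add_mono exp_pos exp_neg) simp
  also have "\<dots> = ennreal (fact (2 * m) * (exp (1 / 8) + exp (1 / 8)))"
    by (simp flip: ennreal_plus ennreal_mult)
  finally have "expectation (\<lambda>\<omega>. (l * T \<omega>) ^ (2 * m)) \<le> fact (2 * m) * (exp (1 / 8) + exp (1 / 8))"
    by (subst (asm) ennreal_le_iff) auto
  also have "(\<lambda>\<omega>. (l * T \<omega>) ^ (2 * m)) = (\<lambda>\<omega>. (1 / n ^ m) * T \<omega> ^ (2 * m))"
    by (simp add: power_mult_distrib power_mult l power_divide)
  also have "expectation (\<lambda>\<omega>. (1 / n ^ m) * T \<omega> ^ (2 * m)) =
      (1 / n ^ m) * expectation (\<lambda>\<omega>. T \<omega> ^ (2 * m))"
    by (rule integral_mult_right_zero)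
  finally show ?thesis
    using n by (simp add: T_def n_def field_simps)
qed

section \<open>Bounded random variables\<close>

text \<open>
Bounds are imposed on the whole space rather than almost everywhere: the Bernoulli variables
satisfy them there, and pointwise bounds are closed under sums and products without null sets.
\<close>
definition bounded_rv :: "'w measure \<Rightarrow> ('w \<Rightarrow> real) \<Rightarrow> bool" where
  "bounded_rv M f \<longleftrightarrow> f \<in> borel_measurable M \<and> (\<exists>b. \<forall>x\<in>space M. \<bar>f x\<bar> \<le> b)"

lemma bounded_rv_const: "bounded_rv M (\<lambda>_. c)"
  by (auto simp: bounded_rv_def)

lemma bounded_rv_add:
  assumes "bounded_rv M f" "bounded_rv M g"
  shows "bounded_rv M (\<lambda>x. f x + g x)"
proof -
  obtain a b where "\<forall>x\<in>space M. \<bar>f x\<bar> \<le> a" "\<forall>x\<in>space M. \<bar>g x\<bar> \<le> b"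
    using assms by (auto simp: bounded_rv_def)
  hence "\<forall>x\<in>space M. \<bar>f x + g x\<bar> \<le> a + b"
    by (meson abs_triangle_ineq add_mono order_trans)
  thus ?thesis using assms by (auto simp: bounded_rv_def)
qed

lemma bounded_rv_mult:
  assumes "bounded_rv M f" "bounded_rv M g"
  shows "bounded_rv M (\<lambda>x. f x * g x)"
proof -
  obtain a b where "\<forall>x\<in>space M. \<bar>f x\<bar> \<le> a" "\<forall>x\<in>space M. \<bar>g x\<bar> \<le> b"
    using assms by (auto simp: bounded_rv_def)
  hence "\<forall>x\<in>space M. \<bar>f x * g x\<bar> \<le> a * b"
    unfolding abs_mult by (meson abs_ge_zero mult_mono order_trans)
  thus ?thesis using assms by (auto simp: bounded_rv_def)
qed

lemma bounded_rv_diff: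
  assumes "bounded_rv M f" "bounded_rv M g"
  shows "bounded_rv M (\<lambda>x. f x - g x)"
  using bounded_rv_add[OF assms(1) bounded_rv_mult[OF bounded_rv_const[of M "- 1"] assms(2)]]
  by simp

lemma bounded_rv_sum:
  assumes "\<And>k. k \<in> K \<Longrightarrow> bounded_rv M (f k)"
  shows "bounded_rv M (\<lambda>x. \<Sum>k\<in>K. f k x)"
  using assms
proof (induction K rule: infinite_finite_induct)
  case (insert k K)
  hence "bounded_rv M (\<lambda>x. f k x + (\<Sum>k\<in>K. f k x))"
    by (intro bounded_rv_add) simp_all
  with insert show ?case by simp
qed (simp_all add: bounded_rv_const)

lemma bounded_rv_square_integrable:
  assumes "prob_space M" and f: "bounded_rv M f"
  shows "f \<in> square_integrable M"
proof -
  interpret prob_space M by fact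
  have [measurable]: "f \<in> borel_measurable M" using f by (simp add: bounded_rv_def)
  obtain b where b: "\<forall>x\<in>space M. \<bar>(f x)\<^sup>2\<bar> \<le> b"
    using bounded_rv_mult[OF f f] by (auto simp: bounded_rv_def power2_eq_square)
  have "integrable M (\<lambda>x. (f x)\<^sup>2)"
    by (rule integrable_const_bound[of _ b]) (use b in \<open>auto intro!: AE_I2\<close>)
  thus ?thesis by (simp add: square_integrable_def)
qed

lemma bounded_rv_integrable:
  assumes "prob_space M" and f: "bounded_rv M f"
  shows "integrable M f"
  using bounded_rv_square_integrable[OF assms] prob_space.finite_measure[OF assms(1)]
  by (auto simp: square_integrable_def intro!: finite_measure.square_integrable_imp_integrable[of M f])

text \<open>
The mean minimizes the mean square deviation.
\<close>
lemma variance_le_square_deviation: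
  assumes M: "prob_space M" and X: "bounded_rv M X"
  shows "prob_space.variance M X \<le> prob_space.expectation M (\<lambda>x. (X x - c)\<^sup>2)"
proof -
  interpret prob_space M by fact
  define \<mu> where "\<mu> = expectation X"
  have Y: "bounded_rv M (\<lambda>x. X x - \<mu>)" by (intro bounded_rv_diff X bounded_rv_const)
  have Y2: "integrable M (\<lambda>x. (X x - \<mu>)\<^sup>2)"
    unfolding power2_eq_square by (intro bounded_rv_integrable M bounded_rv_mult Y)
  have Y1: "integrable M (\<lambda>x. X x - \<mu>)" by (intro bounded_rv_integrable M Y)
  have Y0: "expectation (\<lambda>x. X x - \<mu>) = 0"
    using bounded_rv_integrable[OF M X] by (simp add: \<mu>_def prob_space)
  have "expectation (\<lambda>x. (X x - c)\<^sup>2) =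
      expectation (\<lambda>x. (X x - \<mu>)\<^sup>2 + (2 * (\<mu> - c) * (X x - \<mu>) + (\<mu> - c)\<^sup>2))"
    by (simp add: power2_eq_square algebra_simps)
  also have "\<dots> = expectation (\<lambda>x. (X x - \<mu>)\<^sup>2) +
      (2 * (\<mu> - c) * expectation (\<lambda>x. X x - \<mu>) + (\<mu> - c)\<^sup>2)"
    using Y1 Y2 by (simp add: prob_space)
  also have "\<dots> \<ge> expectation (\<lambda>x. (X x - \<mu>)\<^sup>2)"
    by (simp add: Y0)
  finally show ?thesis by (simp add: \<mu>_def)
qed

section \<open>Quadratic approximation of the mixing law\<close>

lemma convex_combination_ge_min:
  fixes \<alpha> \<gamma> s :: real
  assumes "0 \<le> s" "s \<le> 1"
  shows "min \<alpha> \<gamma> \<le> \<alpha> + s * (\<gamma> - \<alpha>)"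
proof -
  have "(1 - s) * min \<alpha> \<gamma> + s * min \<alpha> \<gamma> \<le> (1 - s) * \<alpha> + s * \<gamma>"
    using assms by (intro add_mono mult_left_mono) auto
  thus ?thesis by (simp add: algebra_simps)
qed

text \<open>
The remainder is explicit: with \<open>u = \<delta> (s - \<eta>)\<close> it equals \<open>- u\<^sup>3 / (d\<^sup>3 (d + u))\<close>, and both
\<open>d\<close> and \<open>d + u\<close> are convex combinations of \<open>\<alpha>\<close> and \<open>\<gamma>\<close>, hence at least \<open>m\<close>.
\<close>
lemma mixed_mean_taylor:
  fixes \<alpha> \<gamma> \<eta> s :: real
  defines "m \<equiv> min \<alpha> \<gamma>" and "\<delta> \<equiv> \<gamma> - \<alpha>"
  defines "d \<equiv> \<alpha> + \<eta> * \<delta>"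
  assumes pos: "\<alpha> > 0" "\<gamma> > 0" and \<eta>: "0 \<le> \<eta>" "\<eta> \<le> 1" and s: "0 \<le> s" "s \<le> 1"
  shows "\<bar>mixed_mean \<alpha> \<gamma> s - (1 / d - \<delta> / d ^ 2 * (s - \<eta>) + \<delta> ^ 2 / d ^ 3 * (s - \<eta>) ^ 2)\<bar>
    \<le> \<bar>\<delta>\<bar> ^ 3 / m ^ 4 * \<bar>s - \<eta>\<bar> ^ 3"
proof -
  define u where "u = \<delta> * (s - \<eta>)"
  have m: "m > 0" using pos by (simp add: m_def)
  have d: "m \<le> d" unfolding d_def m_def \<delta>_def using \<eta> by (rule convex_combination_ge_min)
  have "m \<le> \<alpha> + s * \<delta>" unfolding m_def \<delta>_def using s by (rule convex_combination_ge_min)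
  moreover have "\<alpha> + s * \<delta> = d + u" by (simp add: d_def u_def algebra_simps)
  ultimately have du: "m \<le> d + u" by simp
  have "mixed_mean \<alpha> \<gamma> s - (1 / d - \<delta> / d ^ 2 * (s - \<eta>) + \<delta> ^ 2 / d ^ 3 * (s - \<eta>) ^ 2) =
      1 / (d + u) - (1 / d - u / d ^ 2 + u ^ 2 / d ^ 3)"
    using \<open>\<alpha> + s * \<delta> = d + u\<close>
    by (simp add: mixed_mean_def u_def \<delta>_def[symmetric] power_mult_distrib)
  also have "\<dots> = - (u ^ 3 / (d ^ 3 * (d + u)))"
    using m d du by (simp add: divide_simps) (simp add: power2_eq_square power3_eq_cube algebra_simps)
  also have "\<bar>\<dots>\<bar> = \<bar>u\<bar> ^ 3 / (d ^ 3 * (d + u))"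
    using m d du by (simp add: abs_divide abs_mult power_abs)
  also have "\<dots> \<le> \<bar>u\<bar> ^ 3 / (m ^ 3 * m)"
    using m d du by (intro divide_left_mono mult_mono power_mono mult_pos_pos) auto
  also have "\<dots> = \<bar>\<delta>\<bar> ^ 3 / m ^ 4 * \<bar>s - \<eta>\<bar> ^ 3"
  proof -
    have "\<bar>u\<bar> ^ 3 = \<bar>\<delta>\<bar> ^ 3 * \<bar>s - \<eta>\<bar> ^ 3" by (simp add: u_def abs_mult power_mult_distrib)
    moreover have "m ^ 3 * m = m ^ 4" by (simp add: eval_nat_numeral)
    ultimately show ?thesis by simp
  qed
  finally show ?thesis .
qed

text \<open>
The first and second differences of \<open>h\<close> are the constant values of the one-defect and two-defect
corrections, so the left-hand side is the apparent coefficient minus its first two control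
variates, up to a constant. If \<open>\<alpha> \<noteq> \<gamma>\<close>, neither difference vanishes and every quadratic
polynomial in \<open>S\<close> can be matched; if \<open>\<alpha> = \<gamma>\<close>, only a constant has to be matched.
\<close>
lemma mixed_mean_quadratic_approximation:
  fixes \<alpha> \<gamma> \<eta> :: real and N :: nat
  defines "h \<equiv> mixed_mean \<alpha> \<gamma>"
  assumes pos: "\<alpha> > 0" "\<gamma> > 0" and \<eta>: "0 \<le> \<eta>" "\<eta> \<le> 1" and N: "N \<ge> 2"
  shows "\<exists>\<sigma>1 \<sigma>2 c. \<forall>S. 0 \<le> S \<longrightarrow> S \<le> real N \<longrightarrow>
    \<bar>h (S / N) - \<sigma>1 * ((h (1 / N) - h 0) * S)
       - \<sigma>2 * ((h (2 / N) - h (1 / N) - h (1 / N) + h 0) / 2 * (S\<^sup>2 - S)) - c\<bar>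
    \<le> \<bar>\<gamma> - \<alpha>\<bar> ^ 3 / min \<alpha> \<gamma> ^ 4 * \<bar>S / N - \<eta>\<bar> ^ 3"
proof -
  define \<delta> where "\<delta> = \<gamma> - \<alpha>"
  define d where "d = \<alpha> + \<eta> * \<delta>"
  define e0 e1 e2 where "e0 = 1 / d + \<delta> / d ^ 2 * \<eta> + \<delta> ^ 2 / d ^ 3 * \<eta> ^ 2"
    and "e1 = - \<delta> / d ^ 2 - 2 * \<eta> * (\<delta> ^ 2 / d ^ 3)" and "e2 = \<delta> ^ 2 / d ^ 3"
  define a1 a2 where "a1 = h (1 / N) - h 0" and "a2 = h (2 / N) - h (1 / N) - h (1 / N) + h 0"
  have poly: "1 / d - \<delta> / d ^ 2 * (s - \<eta>) + \<delta> ^ 2 / d ^ 3 * (s - \<eta>) ^ 2 = e0 + e1 * s + e2 * s\<^sup>2" for s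
    unfolding e0_def e1_def e2_def
    by (simp add: power2_eq_square diff_divide_distrib add_divide_distrib algebra_simps)
  have "\<exists>\<sigma>1 \<sigma>2. \<forall>S. \<sigma>1 * (a1 * S) + \<sigma>2 * (a2 / 2 * (S\<^sup>2 - S)) = e1 * (S / N) + e2 * (S / N)\<^sup>2"
  proof (cases "\<delta> = 0")
    case True
    thus ?thesis by (intro exI[of _ 0]) (simp add: e1_def e2_def)
  next
    case False
    define \<beta> where "\<beta> = \<delta> / N"
    have \<beta>: "\<beta> \<noteq> 0" using False N by (simp add: \<beta>_def)
    have p1: "\<alpha> + \<beta> > 0" and p2: "\<alpha> + 2 * \<beta> > 0"
      using convex_combination_ge_min[of "1 / real N" \<alpha> \<gamma>]
        convex_combination_ge_min[of "2 / real N" \<alpha> \<gamma>] pos N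
      by (auto simp: \<beta>_def \<delta>_def)
    have h: "h 0 = 1 / \<alpha>" "h (1 / N) = 1 / (\<alpha> + \<beta>)" "h (2 / N) = 1 / (\<alpha> + 2 * \<beta>)"
      by (simp_all add: h_def mixed_mean_def \<beta>_def \<delta>_def)
    have a1: "a1 \<noteq> 0"
      using pos p1 \<beta> by (simp add: a1_def h divide_simps)
    have "a2 = 2 * \<beta>\<^sup>2 / (\<alpha> * (\<alpha> + \<beta>) * (\<alpha> + 2 * \<beta>))"
      using pos p1 p2 unfolding a2_def h
      by (simp add: divide_simps) (simp add: power2_eq_square algebra_simps)
    hence a2: "a2 \<noteq> 0" using pos p1 p2 \<beta> by simp
    (* Match the coefficients of S^2 and of S; the second variate also contributes to the latter. *)
    define \<sigma>2 where "\<sigma>2 = 2 * e2 / (a2 * real N ^ 2)"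
    define \<sigma>1 where "\<sigma>1 = (e1 + e2 / N) / (a1 * N)"
    have "\<sigma>1 * a1 = e1 / N + e2 / real N ^ 2" "\<sigma>2 * (a2 / 2) = e2 / real N ^ 2"
      using a1 a2 N by (simp_all add: \<sigma>1_def \<sigma>2_def field_simps power2_eq_square)
    hence "\<sigma>1 * (a1 * S) + \<sigma>2 * (a2 / 2 * (S\<^sup>2 - S)) =
        (e1 / N + e2 / real N ^ 2) * S + e2 / real N ^ 2 * (S\<^sup>2 - S)" for S
      by (metis mult.assoc)
    also have "(e1 / N + e2 / real N ^ 2) * S + e2 / real N ^ 2 * (S\<^sup>2 - S) =
        e1 * (S / N) + e2 * (S / N)\<^sup>2" for S
      by (simp add: power_divide diff_divide_distrib algebra_simps)
    finally show ?thesis by blast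
  qed
  then obtain \<sigma>1 \<sigma>2 where \<sigma>: "\<And>S. \<sigma>1 * (a1 * S) + \<sigma>2 * (a2 / 2 * (S\<^sup>2 - S)) =
      e1 * (S / N) + e2 * (S / N)\<^sup>2" by blast
  show ?thesis
  proof (intro exI allI impI)
    fix S :: real assume S: "0 \<le> S" "S \<le> N"
    have s: "0 \<le> S / N" "S / N \<le> 1" using S N by (auto simp: divide_simps)
    have eq: "h (S / N) - \<sigma>1 * (a1 * S) - \<sigma>2 * (a2 / 2 * (S\<^sup>2 - S)) - e0 =
        h (S / N) - (e0 + e1 * (S / N) + e2 * (S / N)\<^sup>2)"
      using \<sigma>[of S] by linarith
    have "\<bar>h (S / N) - (e0 + e1 * (S / N) + e2 * (S / N)\<^sup>2)\<bar>
        \<le> \<bar>\<gamma> - \<alpha>\<bar> ^ 3 / min \<alpha> \<gamma> ^ 4 * \<bar>S / N - \<eta>\<bar> ^ 3"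
      unfolding poly[symmetric] h_def d_def \<delta>_def by (rule mixed_mean_taylor[OF pos \<eta> s])
    thus "\<bar>h (S / N) - \<sigma>1 * ((h (1 / N) - h 0) * S)
       - \<sigma>2 * ((h (2 / N) - h (1 / N) - h (1 / N) + h 0) / 2 * (S\<^sup>2 - S)) - e0\<bar>
      \<le> \<bar>\<gamma> - \<alpha>\<bar> ^ 3 / min \<alpha> \<gamma> ^ 4 * \<bar>S / N - \<eta>\<bar> ^ 3"
      unfolding eq[symmetric] a1_def a2_def .
  qed
qed

section \<open>The controlled variable\<close>

lemma A1_eta_eq:
  fixes N :: nat and B :: "int \<Rightarrow> 'w \<Rightarrow> real" and \<omega> :: 'w
  assumes "admissible A" "admissible C"
  defines "h \<equiv> mixed_mean (mean_inverse A) (mean_inverse C)"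
  shows "A1_eta A C N B \<omega> = (h (1 / N) - h 0) * (\<Sum>k\<in>cells N. B k \<omega>)"
proof -
  have "A1_eta A C N B \<omega> = (\<Sum>k\<in>cells N. B k \<omega> * (h (1 / N) - h 0))"
    unfolding A1_eta_def A1_defect_def
    by (intro sum.cong) (simp_all add: A1_star_eq assms per_star_eq[of A "mean_inverse C"])
  thus ?thesis by (simp add: mult.commute flip: sum_distrib_right)
qed

text \<open>
For Bernoulli values \<open>(B k)\<^sup>2 = B k\<close>, so the sum over ordered pairs of distinct cells is
\<open>S\<^sup>2 - S\<close>.
\<close>
lemma A2_eta_eq:
  fixes N :: nat and B :: "int \<Rightarrow> 'w \<Rightarrow> real" and \<omega> :: 'w
  assumes "admissible A" "admissible C" and B: "\<And>k. B k \<omega> \<in> {0, 1}"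
  defines "h \<equiv> mixed_mean (mean_inverse A) (mean_inverse C)"
    and "S \<equiv> \<Sum>k\<in>cells N. B k \<omega>"
  shows "A2_eta A C N B \<omega> = (h (2 / N) - h (1 / N) - h (1 / N) + h 0) / 2 * (S\<^sup>2 - S)"
proof -
  define a2 where "a2 = h (2 / N) - h (1 / N) - h (1 / N) + h 0"
  have "A2_eta A C N B \<omega> = 1 / 2 * (\<Sum>k\<in>cells N. \<Sum>l\<in>cells N - {k}. B k \<omega> * B l \<omega> * a2)"
    unfolding A2_eta_def A2_defect_def a2_def
    by (intro arg_cong2[of _ _ _ _ "(*)"] sum.cong refl)
      (simp_all add: A2_star_eq A1_star_eq assms per_star_eq[of A "mean_inverse C"])
  also have "(\<Sum>k\<in>cells N. \<Sum>l\<in>cells N - {k}. B k \<omega> * B l \<omega> * a2) =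
      (\<Sum>k\<in>cells N. (S * B k \<omega> - B k \<omega>) * a2)"
  proof (rule sum.cong)
    fix k assume k: "k \<in> cells N"
    have "(\<Sum>l\<in>cells N - {k}. B k \<omega> * B l \<omega> * a2) = a2 * B k \<omega> * (\<Sum>l\<in>cells N - {k}. B l \<omega>)"
      by (simp add: sum_distrib_left mult_ac)
    also have "(\<Sum>l\<in>cells N - {k}. B l \<omega>) = S - B k \<omega>"
      using k by (simp add: S_def sum_diff1 finite_cells)
    also have "a2 * B k \<omega> * (S - B k \<omega>) = (S * B k \<omega> - B k \<omega>) * a2"
      using B[of k] by (auto simp: algebra_simps)
    finally show "(\<Sum>l\<in>cells N - {k}. B k \<omega> * B l \<omega> * a2) = (S * B k \<omega> - B k \<omega>) * a2" .
  qed simp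
  also have "\<dots> = (S * S - S) * a2"
    unfolding sum_distrib_right[symmetric] sum_subtractf sum_distrib_left[symmetric]
    by (simp add: S_def)
  finally show ?thesis by (simp add: a2_def power2_eq_square)
qed

lemma A_star_bounded_rv:
  assumes M: "prob_space M" and B: "bernoulli_iid M \<eta> B"
    and A: "admissible A" "admissible C" and N: "N > 0"
  shows "bounded_rv M (A_star A C B N)"
proof -
  let ?\<alpha> = "mean_inverse A" and ?\<gamma> = "mean_inverse C"
  define g where "g \<omega> = mixed_mean ?\<alpha> ?\<gamma> ((\<Sum>k\<in>cells N. B k \<omega>) / real N)" for \<omega>
  note [measurable] = bernoulli_measurable[OF M B]
  have eq: "A_star A C B N \<omega> = g \<omega>" if "\<omega> \<in> space M" for \<omega>
    unfolding g_def using bernoulli_values[OF M B that] by (intro A_star_eq A N)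
  have "g \<in> borel_measurable M" unfolding g_def mixed_mean_def by measurable
  hence meas: "A_star A C B N \<in> borel_measurable M"
    by (rule measurable_cong[THEN iffD1, rotated]) (simp add: eq)
  have m: "0 < min ?\<alpha> ?\<gamma>" using A by (simp add: mean_inverse_pos)
  have "\<bar>A_star A C B N \<omega>\<bar> \<le> 1 / min ?\<alpha> ?\<gamma>" if \<omega>: "\<omega> \<in> space M" for \<omega>
  proof -
    have b: "0 \<le> B k \<omega> \<and> B k \<omega> \<le> 1" for k using bernoulli_values[OF M B \<omega>, of k] by auto
    have "(\<Sum>k\<in>cells N. B k \<omega>) \<le> (\<Sum>k\<in>cells N. 1)" using b by (intro sum_mono) simp
    hence "min ?\<alpha> ?\<gamma> \<le> ?\<alpha> + (\<Sum>k\<in>cells N. B k \<omega>) / N * (?\<gamma> - ?\<alpha>)"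
      using N b by (intro convex_combination_ge_min) (simp_all add: sum_nonneg card_cells)
    thus ?thesis
      using m unfolding eq[OF \<omega>] g_def mixed_mean_def by (simp add: frac_le)
  qed
  with meas show ?thesis by (auto simp: bounded_rv_def)
qed

lemma bernoulli_bounded_rv:
  assumes "prob_space M" "bernoulli_iid M \<eta> B"
  shows "bounded_rv M (B k)"
proof -
  have "\<bar>B k \<omega>\<bar> \<le> 1" if "\<omega> \<in> space M" for \<omega>
    using bernoulli_values[OF assms that, of k] by auto
  thus ?thesis using bernoulli_measurable[OF assms] by (auto simp: bounded_rv_def)
qed

lemma control_variates_bounded_rv:
  assumes "prob_space M" "bernoulli_iid M \<eta> B"
  shows A1_eta_bounded_rv: "bounded_rv M (A1_eta A C N B)"
    and A2_eta_bounded_rv: "bounded_rv M (A2_eta A C N B)"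
    and C2_eta_bounded_rv: "bounded_rv M (C2_eta A C N B)"
  unfolding A1_eta_def[abs_def] A2_eta_def[abs_def] C2_eta_def[abs_def]
  by (intro bounded_rv_sum bounded_rv_mult bounded_rv_diff bounded_rv_const
      bernoulli_bounded_rv[OF assms])+

lemma D3_bounded_rv:
  assumes "prob_space M" "bernoulli_iid M \<eta> B" "admissible A" "admissible C" "N > 0"
  shows "bounded_rv M (D3 M \<eta> B A C N \<sigma>1 \<sigma>2 \<sigma>3)"
  unfolding D3_def[abs_def]
  by (intro bounded_rv_diff bounded_rv_mult bounded_rv_const A_star_bounded_rv[OF assms]
      control_variates_bounded_rv[OF assms(1,2)])

text \<open>
The coefficients are those that remove the Taylor polynomial of degree two; the cubic remainder
contributes the sixth moment of the centered sum, of order \<open>N ^ 3\<close>, divided by \<open>N ^ 6\<close>.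
\<close>
lemma controlled_variance_le:
  assumes M: "prob_space M" and \<eta>: "0 \<le> \<eta>" "\<eta> \<le> 1" and B: "bernoulli_iid M \<eta> B"
    and A: "admissible A" "admissible C" and N: "N \<ge> 2"
  defines "\<kappa> \<equiv> \<bar>mean_inverse C - mean_inverse A\<bar> ^ 3 / min (mean_inverse A) (mean_inverse C) ^ 4"
  shows "\<exists>\<sigma>1 \<sigma>2. prob_space.variance M (D3 M \<eta> B A C N \<sigma>1 \<sigma>2 0) \<le>
    \<kappa>\<^sup>2 * (2 * fact 6 * exp (1 / 8)) / real N ^ 3"
proof -
  interpret prob_space M by fact
  let ?\<alpha> = "mean_inverse A" and ?\<gamma> = "mean_inverse C"
  let ?h = "mixed_mean ?\<alpha> ?\<gamma>"
  define S where "S \<omega> = (\<Sum>k\<in>cells N. B k \<omega>)" for \<omega>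
  obtain \<sigma>1 \<sigma>2 c where approx: "\<And>S. 0 \<le> S \<Longrightarrow> S \<le> real N \<Longrightarrow>
      \<bar>?h (S / N) - \<sigma>1 * ((?h (1 / N) - ?h 0) * S)
       - \<sigma>2 * ((?h (2 / N) - ?h (1 / N) - ?h (1 / N) + ?h 0) / 2 * (S\<^sup>2 - S)) - c\<bar>
      \<le> \<kappa> * \<bar>S / N - \<eta>\<bar> ^ 3"
    using mixed_mean_quadratic_approximation[OF mean_inverse_pos mean_inverse_pos \<eta> N, OF A]
    unfolding \<kappa>_def by blast
  let ?D = "D3 M \<eta> B A C N \<sigma>1 \<sigma>2 0"
  define c' where "c' = c + \<sigma>1 * (\<eta> * A1_bar A C N) + \<sigma>2 * (\<eta>\<^sup>2 * A2_bar A C N)"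
  have rv_D: "bounded_rv M ?D"
    by (rule D3_bounded_rv[OF M B A]) (use N in simp)
  have dev: "(?D \<omega> - c')\<^sup>2 \<le> \<kappa>\<^sup>2 / real N ^ 6 * (\<Sum>k\<in>cells N. B k \<omega> - \<eta>) ^ 6"
    if \<omega>: "\<omega> \<in> space M" for \<omega>
  proof -
    have val: "\<And>k. B k \<omega> \<in> {0, 1}" using bernoulli_values[OF M B \<omega>] .
    hence b: "0 \<le> B k \<omega> \<and> B k \<omega> \<le> 1" for k by (metis insertE singletonD zero_le_one order_refl)
    have "S \<omega> \<le> (\<Sum>k\<in>cells N. 1)" unfolding S_def using b by (intro sum_mono) simp
    hence S: "0 \<le> S \<omega>" "S \<omega> \<le> N" using b by (simp_all add: S_def sum_nonneg card_cells)
    have "?D \<omega> - c' = ?h (S \<omega> / N) - \<sigma>1 * ((?h (1 / N) - ?h 0) * S \<omega>)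
       - \<sigma>2 * ((?h (2 / N) - ?h (1 / N) - ?h (1 / N) + ?h 0) / 2 * ((S \<omega>)\<^sup>2 - S \<omega>)) - c"
      using N unfolding D3_def c'_def S_def
      by (simp add: A_star_eq[where B = B and \<omega> = \<omega>, OF A _ val] A1_eta_eq[OF A]
          A2_eta_eq[where B = B and \<omega> = \<omega>, OF A val] right_diff_distrib)
    hence "\<bar>?D \<omega> - c'\<bar> \<le> \<kappa> * \<bar>S \<omega> / N - \<eta>\<bar> ^ 3"
      using approx[OF S] by simp
    hence "(?D \<omega> - c')\<^sup>2 \<le> (\<kappa> * \<bar>S \<omega> / N - \<eta>\<bar> ^ 3)\<^sup>2"
      by (metis abs_ge_zero power2_abs power_mono)
    also have "\<dots> = \<kappa>\<^sup>2 * (S \<omega> / N - \<eta>) ^ 6"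
      by (simp add: power_mult_distrib flip: power_mult)
    also have "S \<omega> / N - \<eta> = (\<Sum>k\<in>cells N. B k \<omega> - \<eta>) / N"
      using N by (simp add: S_def sum_subtractf card_cells diff_divide_distrib)
    finally show ?thesis by (simp add: power_divide)
  qed
  have "variance ?D \<le> expectation (\<lambda>\<omega>. (?D \<omega> - c')\<^sup>2)"
    by (rule variance_le_square_deviation[OF M rv_D])
  also have "\<dots> \<le> expectation (\<lambda>\<omega>. \<kappa>\<^sup>2 / real N ^ 6 * (\<Sum>k\<in>cells N. B k \<omega> - \<eta>) ^ 6)"
  proof (rule integral_mono)
    show "integrable M (\<lambda>\<omega>. (?D \<omega> - c')\<^sup>2)"
      unfolding power2_eq_square
      by (intro bounded_rv_integrable M bounded_rv_mult bounded_rv_diff rv_D bounded_rv_const)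
    have "bounded_rv M (\<lambda>\<omega>. \<Sum>k\<in>cells N. B k \<omega> - \<eta>)" (is "bounded_rv M ?T")
      by (intro bounded_rv_sum bounded_rv_diff bernoulli_bounded_rv[OF M B] bounded_rv_const)
    hence "integrable M (\<lambda>\<omega>. \<kappa>\<^sup>2 / real N ^ 6 * (?T \<omega> * (?T \<omega> * (?T \<omega> * (?T \<omega> * (?T \<omega> * ?T \<omega>))))))"
      by (intro bounded_rv_integrable M bounded_rv_mult bounded_rv_const)
    thus "integrable M (\<lambda>\<omega>. \<kappa>\<^sup>2 / real N ^ 6 * ?T \<omega> ^ 6)"
      by (simp add: eval_nat_numeral)
  qed (rule dev)
  also have "\<dots> = \<kappa>\<^sup>2 / real N ^ 6 * expectation (\<lambda>\<omega>. (\<Sum>k\<in>cells N. B k \<omega> - \<eta>) ^ 6)"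
    by (rule integral_mult_right_zero)
  also have "\<dots> \<le> \<kappa>\<^sup>2 / real N ^ 6 * (2 * fact 6 * exp (1 / 8) * real N ^ 3)"
    using bernoulli_even_moment[OF M B finite_cells, of N 3] N
    by (intro mult_left_mono) (auto simp: card_cells cells_eq)
  also have "\<dots> = \<kappa>\<^sup>2 * (2 * fact 6 * exp (1 / 8)) / real N ^ 3"
    using N by (simp add: field_simps flip: power_add)
  finally show ?thesis by blast
qed

lemma controlled_variance_attains_min:
  assumes M: "prob_space M" and B: "bernoulli_iid M \<eta> B"
    and A: "admissible A" "admissible C" and N: "N > 0"
  shows "\<exists>\<rho>1 \<rho>2 \<rho>3. \<forall>\<sigma>1 \<sigma>2 \<sigma>3.
    prob_space.variance M (D3 M \<eta> B A C N \<rho>1 \<rho>2 \<rho>3) \<le>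
    prob_space.variance M (D3 M \<eta> B A C N \<sigma>1 \<sigma>2 \<sigma>3)"
proof -
  interpret prob_space M by fact
  note centered = bounded_rv_square_integrable[OF M bounded_rv_diff[OF _ bounded_rv_const]]
  show ?thesis
    unfolding D3_def[abs_def]
    by (intro variance_minimizer centered control_variates_bounded_rv[OF M B]
        bounded_rv_square_integrable[OF M] A_star_bounded_rv[OF M B A N])
qed

theorem proposition13:
  fixes M :: "'w measure" and \<eta> :: real and B :: "int \<Rightarrow> 'w \<Rightarrow> real"
    and A C :: "real \<Rightarrow> real"
  assumes "prob_space M"
    and "0 < \<eta>" and "\<eta> < 1"
    and "bernoulli_iid M \<eta> B"
    and "admissible A" and "admissible C"
  shows "\<exists>\<rho>1 \<rho>2 \<rho>3 :: nat \<Rightarrow> real.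
    (\<forall>N\<ge>2. \<forall>\<sigma>1 \<sigma>2 \<sigma>3.
       prob_space.variance M (D3 M \<eta> B A C N (\<rho>1 N) (\<rho>2 N) (\<rho>3 N))
       \<le> prob_space.variance M (D3 M \<eta> B A C N \<sigma>1 \<sigma>2 \<sigma>3)) \<and>
    (\<lambda>N. prob_space.variance M (D3 M \<eta> B A C N (\<rho>1 N) (\<rho>2 N) (\<rho>3 N)))
      \<in> O(\<lambda>N. 1 / real N ^ 3)"
proof -
  let ?V = "\<lambda>N \<sigma>1 \<sigma>2 \<sigma>3. prob_space.variance M (D3 M \<eta> B A C N \<sigma>1 \<sigma>2 \<sigma>3)"
  have "\<forall>N. \<exists>r. N \<ge> 2 \<longrightarrow> (\<forall>\<sigma>1 \<sigma>2 \<sigma>3. ?V N (fst r) (fst (snd r)) (snd (snd r)) \<le> ?V N \<sigma>1 \<sigma>2 \<sigma>3)"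
  proof
    fix N :: nat
    show "\<exists>r. N \<ge> 2 \<longrightarrow> (\<forall>\<sigma>1 \<sigma>2 \<sigma>3. ?V N (fst r) (fst (snd r)) (snd (snd r)) \<le> ?V N \<sigma>1 \<sigma>2 \<sigma>3)"
    proof (cases "N \<ge> 2")
      case True
      then obtain \<rho>1 \<rho>2 \<rho>3 where "\<forall>\<sigma>1 \<sigma>2 \<sigma>3. ?V N \<rho>1 \<rho>2 \<rho>3 \<le> ?V N \<sigma>1 \<sigma>2 \<sigma>3"
        using controlled_variance_attains_min[OF assms(1,4-6), of N] by auto
      thus ?thesis by (intro exI[of _ "(\<rho>1, \<rho>2, \<rho>3)"]) simp
    qed simp
  qed
  then obtain r where r: "\<And>N \<sigma>1 \<sigma>2 \<sigma>3. N \<ge> 2 \<Longrightarrow>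
      ?V N (fst (r N)) (fst (snd (r N))) (snd (snd (r N))) \<le> ?V N \<sigma>1 \<sigma>2 \<sigma>3"
    by metis
  define \<rho>1 \<rho>2 \<rho>3 where "\<rho>1 N = fst (r N)" and "\<rho>2 N = fst (snd (r N))"
    and "\<rho>3 N = snd (snd (r N))" for N
  have min: "?V N (\<rho>1 N) (\<rho>2 N) (\<rho>3 N) \<le> ?V N \<sigma>1 \<sigma>2 \<sigma>3" if "N \<ge> 2" for N \<sigma>1 \<sigma>2 \<sigma>3
    using r[OF that] by (simp add: \<rho>1_def \<rho>2_def \<rho>3_def)
  define \<kappa> where
    "\<kappa> = \<bar>mean_inverse C - mean_inverse A\<bar> ^ 3 / min (mean_inverse A) (mean_inverse C) ^ 4"
  have bound: "?V N (\<rho>1 N) (\<rho>2 N) (\<rho>3 N) \<le> \<kappa>\<^sup>2 * (2 * fact 6 * exp (1 / 8)) / real N ^ 3"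
    if N: "N \<ge> 2" for N
  proof -
    obtain \<sigma>1 \<sigma>2 where "?V N \<sigma>1 \<sigma>2 0 \<le> \<kappa>\<^sup>2 * (2 * fact 6 * exp (1 / 8)) / real N ^ 3"
      using controlled_variance_le[OF assms(1) _ _ assms(4-6) N] assms(2,3)
      unfolding \<kappa>_def by auto
    with min[OF N, of \<sigma>1 \<sigma>2 0] show ?thesis by linarith
  qed
  have "(\<lambda>N. ?V N (\<rho>1 N) (\<rho>2 N) (\<rho>3 N)) \<in> O(\<lambda>N. 1 / real N ^ 3)"
  proof (rule landau_o.bigI)
    show "0 < \<kappa>\<^sup>2 * (2 * fact 6 * exp (1 / 8)) + 1" by (simp add: add_nonneg_pos)
    have "norm (?V N (\<rho>1 N) (\<rho>2 N) (\<rho>3 N)) \<le>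
        (\<kappa>\<^sup>2 * (2 * fact 6 * exp (1 / 8)) + 1) * norm (1 / real N ^ 3)" if N: "N \<ge> 2" for N
    proof -
      have "0 \<le> ?V N (\<rho>1 N) (\<rho>2 N) (\<rho>3 N)" by simp
      hence "norm (?V N (\<rho>1 N) (\<rho>2 N) (\<rho>3 N)) \<le> \<kappa>\<^sup>2 * (2 * fact 6 * exp (1 / 8)) / real N ^ 3"
        using bound[OF N] by simp
      also have "\<dots> \<le> (\<kappa>\<^sup>2 * (2 * fact 6 * exp (1 / 8)) + 1) / real N ^ 3"
        by (intro divide_right_mono) auto
      finally show ?thesis by simp
    qed
    thus "\<forall>\<^sub>F N in sequentially. norm (?V N (\<rho>1 N) (\<rho>2 N) (\<rho>3 N)) \<le>
        (\<kappa>\<^sup>2 * (2 * fact 6 * exp (1 / 8)) + 1) * norm (1 / real N ^ 3)"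
      using eventually_ge_at_top[of 2] by (rule eventually_mono[rotated])
  qed
  with min show ?thesis by blast
qed

end
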